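(* For every $z''\in B_{\ell_1''}$, the fiber $\mathcal M_{z''}$ intersects $2^{\mathfrak c}$ different Gleason parts of $\mathcal M(\mathcal A_u(B_{\ell_1}))$.
   Context: $\ell_1$ is the complex sequence space, $B_{\ell_1}$ its open unit ball, $B_{\ell_1''}$ the open unit ball of its bidual. $\mathcal A_u(B_{\ell_1})$ is the Banach algebra, with the supremum norm, of all uniformly continuous holomorphic functions $f:B_{\ell_1}\to\mathbb C$. $\mathcal M(\mathcal A_u(B_{\ell_1}))$ is its spectrum: the set of all non-zero multiplicative linear functionals. The fiber over $z''\in\overline B_{\ell_1''}$ is $\mathcal M_{z''}=\{\varphi\in\mathcal M(\mathcal A_u(B_{\ell_1})): \varphi(x')=z''(x')\text{ for all }x'\in\ell_1'\}$ (continuous linear functionals being regarded as elements of $\mathcal A_u(B_{\ell_1})$). The Gleason part of $\varphi$ is $\mathcal{GP}(\varphi)=\{\psi\in\mathcal M(\mathcal A_u(B_{\ell_1})): \|\varphi-\psi\|<2\}$, where $\|\varphi-\psi\|=\sup\{|\varphi(f)-\psi(f)|:\|f\|\le1\}$; Gleason parts are the classes of an equivalence relation. $\mathfrak c$ is the cardinality of the continuum. *)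

theory Defs
  imports "HOL-Analysis.Analysis" "HOL-Library.Equipollence"
begin

subsection \<open>Complex normed spaces\<close>

class complex_normed_vector = real_normed_vector +
  fixes scaleC :: "complex \<Rightarrow> 'a \<Rightarrow> 'a" (infixr \<open>*\<^sub>C\<close> 75)
  assumes scaleC_add_right: "c *\<^sub>C (x + y) = c *\<^sub>C x + c *\<^sub>C y"
    and scaleC_add_left: "(c + d) *\<^sub>C x = c *\<^sub>C x + d *\<^sub>C x"
    and scaleC_scaleC: "c *\<^sub>C (d *\<^sub>C x) = (c * d) *\<^sub>C x"
    and scaleC_of_real: "complex_of_real r *\<^sub>C x = r *\<^sub>R x"
    and norm_scaleC: "norm (c *\<^sub>C x) = cmod c * norm x"

instantiation complex :: complex_normed_vector
begin

definition scaleC_complex :: "complex \<Rightarrow> complex \<Rightarrow> complex" where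
  "scaleC_complex = (*)"

instance
  by standard (simp_all add: scaleC_complex_def algebra_simps norm_mult scaleR_conv_of_real)

end

definition clinear :: "('a::complex_normed_vector \<Rightarrow> 'b::complex_normed_vector) \<Rightarrow> bool" where
  "clinear f \<longleftrightarrow> (\<forall>x y. f (x + y) = f x + f y) \<and> (\<forall>c x. f (c *\<^sub>C x) = c *\<^sub>C f x)"

definition bounded_clinear :: "('a::complex_normed_vector \<Rightarrow> 'b::complex_normed_vector) \<Rightarrow> bool" where
  "bounded_clinear f \<longleftrightarrow> clinear f \<and> (\<exists>K. \<forall>x. norm (f x) \<le> K * norm x)"

lemma bounded_clinear_bounded_linear: "bounded_clinear f \<Longrightarrow> bounded_linear f"
  unfolding bounded_clinear_def clinear_def
  by (metis bounded_linear_intro mult.commute scaleC_of_real)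

lemma bounded_clinear_iff:
  "bounded_clinear f \<longleftrightarrow> bounded_linear f \<and> (\<forall>c x. f (c *\<^sub>C x) = c *\<^sub>C f x)"
proof
  assume "bounded_clinear f"
  then show "bounded_linear f \<and> (\<forall>c x. f (c *\<^sub>C x) = c *\<^sub>C f x)"
    using bounded_clinear_bounded_linear by (auto simp: bounded_clinear_def clinear_def)
next
  assume *: "bounded_linear f \<and> (\<forall>c x. f (c *\<^sub>C x) = c *\<^sub>C f x)"
  then interpret bounded_linear f by blast
  show "bounded_clinear f"
    unfolding bounded_clinear_def clinear_def
    using * bounded add by (metis mult.commute)
qed

subsection \<open>The topological dual\<close>

typedef (overloaded) 'a cdual =
  "{f :: 'a::complex_normed_vector \<Rightarrow> complex. bounded_clinear f}"
  morphisms cdual_apply Abs_cdual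
  by (rule exI[of _ "\<lambda>_. 0"]) (auto simp: bounded_clinear_def clinear_def scaleC_complex_def intro: exI[of _ 0])

setup_lifting type_definition_cdual

instantiation cdual :: (complex_normed_vector) complex_normed_vector
begin

lift_definition zero_cdual :: "'a cdual" is "\<lambda>_. 0"
  by (simp add: bounded_clinear_iff scaleC_complex_def)

lift_definition plus_cdual :: "'a cdual \<Rightarrow> 'a cdual \<Rightarrow> 'a cdual" is "\<lambda>f g x. f x + g x"
  by (simp add: bounded_clinear_iff bounded_linear_add scaleC_add_right)

lift_definition minus_cdual :: "'a cdual \<Rightarrow> 'a cdual \<Rightarrow> 'a cdual" is "\<lambda>f g x. f x - g x"
  by (simp add: bounded_clinear_iff bounded_linear_sub scaleC_complex_def algebra_simps)

lift_definition uminus_cdual :: "'a cdual \<Rightarrow> 'a cdual" is "\<lambda>f x. - f x"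
  by (simp add: bounded_clinear_iff bounded_linear_minus scaleC_complex_def)

lift_definition scaleR_cdual :: "real \<Rightarrow> 'a cdual \<Rightarrow> 'a cdual" is "\<lambda>r f x. r *\<^sub>R f x"
  by (simp add: bounded_clinear_iff bounded_linear_scaleR_const bounded_linear_const_scaleR scaleC_complex_def)

lift_definition scaleC_cdual :: "complex \<Rightarrow> 'a cdual \<Rightarrow> 'a cdual" is "\<lambda>c f x. c * f x"
  by (simp add: bounded_clinear_iff bounded_linear_const_mult scaleC_complex_def)

lift_definition norm_cdual :: "'a cdual \<Rightarrow> real" is onorm .

definition dist_cdual :: "'a cdual \<Rightarrow> 'a cdual \<Rightarrow> real" where
  "dist_cdual f g = norm (f - g)"

definition sgn_cdual :: "'a cdual \<Rightarrow> 'a cdual" where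
  "sgn_cdual f = scaleR (inverse (norm f)) f"

definition uniformity_cdual :: "('a cdual \<times> 'a cdual) filter" where
  "uniformity_cdual = (INF e\<in>{0<..}. principal {(x, y). dist x y < e})"

definition open_cdual :: "'a cdual set \<Rightarrow> bool" where
  "open_cdual U = (\<forall>x\<in>U. \<forall>\<^sub>F (x', y) in uniformity. x' = x \<longrightarrow> y \<in> U)"

instance
proof
  fix f g h :: "'a cdual" and r s :: real and c d :: complex
  show "f + g + h = f + (g + h)" "f + g = g + f" "0 + f = f" "- f + f = 0" "f - g = f + - g"
    "r *\<^sub>R (f + g) = r *\<^sub>R f + r *\<^sub>R g" "(r + s) *\<^sub>R f = r *\<^sub>R f + s *\<^sub>R f"
    "r *\<^sub>R s *\<^sub>R f = (r * s) *\<^sub>R f" "1 *\<^sub>R f = f"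
    "c *\<^sub>C (f + g) = c *\<^sub>C f + c *\<^sub>C g" "(c + d) *\<^sub>C f = c *\<^sub>C f + d *\<^sub>C f"
    "c *\<^sub>C d *\<^sub>C f = (c * d) *\<^sub>C f" "complex_of_real r *\<^sub>C f = r *\<^sub>R f"
    by (transfer; simp add: fun_eq_iff algebra_simps scaleR_conv_of_real)+
  show "dist f g = norm (f - g)" "sgn f = inverse (norm f) *\<^sub>R f"
    by (simp_all add: dist_cdual_def sgn_cdual_def)
  show "(uniformity :: ('a cdual \<times> 'a cdual) filter) = (INF e\<in>{0<..}. principal {(x, y). dist x y < e})"
    by (simp add: uniformity_cdual_def)
  show "open U = (\<forall>x\<in>U. \<forall>\<^sub>F (x', y) in uniformity. x' = x \<longrightarrow> y \<in> U)" for U :: "'a cdual set"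
    by (simp add: open_cdual_def)
  show "(norm f = 0) = (f = 0)"
    by transfer (auto simp: onorm_eq_0 bounded_clinear_iff)
  show "norm (f + g) \<le> norm f + norm g"
    by transfer (auto simp: onorm_triangle bounded_clinear_iff)
  show "norm (r *\<^sub>R f) = \<bar>r\<bar> * norm f"
    by transfer (auto simp: onorm_scaleR bounded_clinear_iff)
  show "norm (c *\<^sub>C f) = cmod c * norm f"
  proof -
    have *: "onorm (\<lambda>x. c * f x) = cmod c * onorm f"
      if "bounded_clinear f" for c and f :: "'a \<Rightarrow> complex"
    proof -
      from that have f: "bounded_linear f" by (rule bounded_clinear_bounded_linear)
      then have cf: "bounded_linear (\<lambda>x. c * f x)" by (rule bounded_linear_const_mult)
      have "onorm (\<lambda>x. c * f x) \<le> cmod c * onorm f"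
        by (rule onorm_bound) (simp_all add: norm_mult mult.assoc mult_left_mono onorm[OF f] onorm_pos_le[OF f])
      moreover have "cmod c * onorm f \<le> onorm (\<lambda>x. c * f x)"
      proof (cases "c = 0")
        case False
        have "onorm f \<le> onorm (\<lambda>x. c * f x) / cmod c"
          by (rule onorm_bound) (use False onorm[OF cf] onorm_pos_le[OF cf] in \<open>simp_all add: norm_mult field_simps\<close>)
        then show ?thesis using False by (simp add: field_simps)
      qed (simp add: onorm_zero)
      ultimately show ?thesis by simp
    qed
    show ?thesis by transfer (simp add: *)
  qed
qed

end

subsection \<open>The space \<open>\<ell>\<^sub>1\<close>\<close>

typedef l1 = "{x :: nat \<Rightarrow> complex. summable (\<lambda>n. cmod (x n))}"
  morphisms l1_nth Abs_l1
  by (rule exI[of _ "\<lambda>_. 0"]) simp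

setup_lifting type_definition_l1

lemma summable_cmod_add:
  "summable (\<lambda>n. cmod (x n)) \<Longrightarrow> summable (\<lambda>n. cmod (y n)) \<Longrightarrow> summable (\<lambda>n. cmod (x n + y n))"
  by (rule summable_comparison_test'[where g = "\<lambda>n. cmod (x n) + cmod (y n)" and N = 0])
    (auto intro: summable_add norm_triangle_ineq)

instantiation l1 :: complex_normed_vector
begin

lift_definition zero_l1 :: l1 is "\<lambda>_. 0" by simp

lift_definition plus_l1 :: "l1 \<Rightarrow> l1 \<Rightarrow> l1" is "\<lambda>x y n. x n + y n"
  by (rule summable_cmod_add)

lift_definition uminus_l1 :: "l1 \<Rightarrow> l1" is "\<lambda>x n. - x n" by simp

lift_definition minus_l1 :: "l1 \<Rightarrow> l1 \<Rightarrow> l1" is "\<lambda>x y n. x n - y n"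
  using summable_cmod_add[of _ "\<lambda>n. - _ n"] by fastforce

lift_definition scaleR_l1 :: "real \<Rightarrow> l1 \<Rightarrow> l1" is "\<lambda>r x n. r *\<^sub>R x n"
  by (simp add: summable_mult)

lift_definition scaleC_l1 :: "complex \<Rightarrow> l1 \<Rightarrow> l1" is "\<lambda>c x n. c * x n"
  by (simp add: norm_mult summable_mult)

lift_definition norm_l1 :: "l1 \<Rightarrow> real" is "\<lambda>x. \<Sum>n. cmod (x n)" .

definition dist_l1 :: "l1 \<Rightarrow> l1 \<Rightarrow> real" where
  "dist_l1 x y = norm (x - y)"

definition sgn_l1 :: "l1 \<Rightarrow> l1" where
  "sgn_l1 x = scaleR (inverse (norm x)) x"

definition uniformity_l1 :: "(l1 \<times> l1) filter" where
  "uniformity_l1 = (INF e\<in>{0<..}. principal {(x, y). dist x y < e})"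

definition open_l1 :: "l1 set \<Rightarrow> bool" where
  "open_l1 U = (\<forall>x\<in>U. \<forall>\<^sub>F (x', y) in uniformity. x' = x \<longrightarrow> y \<in> U)"

instance
proof
  fix x y z :: l1 and r s :: real and c d :: complex
  show "x + y + z = x + (y + z)" "x + y = y + x" "0 + x = x" "- x + x = 0" "x - y = x + - y"
    "r *\<^sub>R (x + y) = r *\<^sub>R x + r *\<^sub>R y" "(r + s) *\<^sub>R x = r *\<^sub>R x + s *\<^sub>R x"
    "r *\<^sub>R s *\<^sub>R x = (r * s) *\<^sub>R x" "1 *\<^sub>R x = x"
    "c *\<^sub>C (x + y) = c *\<^sub>C x + c *\<^sub>C y" "(c + d) *\<^sub>C x = c *\<^sub>C x + d *\<^sub>C x"
    "c *\<^sub>C d *\<^sub>C x = (c * d) *\<^sub>C x" "complex_of_real r *\<^sub>C x = r *\<^sub>R x"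
    by (transfer; simp add: fun_eq_iff algebra_simps scaleR_conv_of_real)+
  show "dist x y = norm (x - y)" "sgn x = inverse (norm x) *\<^sub>R x"
    by (simp_all add: dist_l1_def sgn_l1_def)
  show "(uniformity :: (l1 \<times> l1) filter) = (INF e\<in>{0<..}. principal {(x, y). dist x y < e})"
    by (simp add: uniformity_l1_def)
  show "open U = (\<forall>x\<in>U. \<forall>\<^sub>F (x', y) in uniformity. x' = x \<longrightarrow> y \<in> U)" for U :: "l1 set"
    by (simp add: open_l1_def)
  show "(norm x = 0) = (x = 0)"
    by transfer (auto simp: suminf_eq_zero_iff)
  show "norm (x + y) \<le> norm x + norm y"
    by transfer (simp add: suminf_add suminf_le norm_triangle_ineq summable_add summable_cmod_add)
  show "norm (r *\<^sub>R x) = \<bar>r\<bar> * norm x"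
    by transfer (simp add: suminf_mult)
  show "norm (c *\<^sub>C x) = cmod c * norm x"
    by transfer (simp add: norm_mult suminf_mult)
qed

end

subsection \<open>Uniformly continuous holomorphic functions on the open unit ball\<close>

definition cholomorphic_on :: "('a::complex_normed_vector \<Rightarrow> complex) \<Rightarrow> 'a set \<Rightarrow> bool" where
  "cholomorphic_on f U \<longleftrightarrow> (\<forall>x\<in>U. \<exists>f'. bounded_clinear f' \<and> (f has_derivative f') (at x))"

text \<open>Functions on the ball are encoded as total functions vanishing outside of it.\<close>

definition Au_set :: "('a::complex_normed_vector \<Rightarrow> complex) set" where
  "Au_set = {f. cholomorphic_on f (ball 0 1) \<and> uniformly_continuous_on (ball 0 1) f \<and>
                (\<forall>x. x \<notin> ball 0 1 \<longrightarrow> f x = 0)}"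

lemma cholomorphic_on_cong:
  assumes "open U" "\<And>x. x \<in> U \<Longrightarrow> f x = g x"
  shows "cholomorphic_on f U = cholomorphic_on g U"
  unfolding cholomorphic_on_def
  using assms has_derivative_transform_within_open[of _ _ _ UNIV U]
  by (smt (verit, best))

lemma cholomorphic_on_clinear: "bounded_clinear f \<Longrightarrow> cholomorphic_on f U"
  unfolding cholomorphic_on_def
  using bounded_clinear_bounded_linear bounded_linear_imp_has_derivative by blast

lemma Au_set_boundedE:
  assumes "f \<in> Au_set"
  obtains K where "K > 0" "\<And>x. cmod (f x) \<le> K"
proof -
  from assms obtain d where d: "d > 0"
    "\<And>x y. x \<in> ball 0 1 \<Longrightarrow> y \<in> ball 0 1 \<Longrightarrow> dist y x < d \<Longrightarrow> dist (f y) (f x) < 1"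
    unfolding Au_set_def uniformly_continuous_on_def by (auto dest: spec[of _ 1])
  obtain N :: nat where N: "N > 0" "1 / real N < d"
    using d(1) by (metis gr0I nat_approx_posE of_nat_0_less_iff zero_less_Suc)
  have step: "cmod (f ((real k / real N) *\<^sub>R x)) \<le> cmod (f 0) + real k"
    if x: "x \<in> ball 0 1" and "k \<le> N" for x k
    using \<open>k \<le> N\<close>
  proof (induction k)
    case 0
    then show ?case by simp
  next
    case (Suc k)
    have in_ball: "(real j / real N) *\<^sub>R x \<in> ball 0 1" if "j \<le> N" for j
    proof -
      have "real j / real N * norm x \<le> 1 * norm x"
        using that N by (intro mult_right_mono) auto
      then show ?thesis using x by simp
    qed
    have "dist ((real (Suc k) / real N) *\<^sub>R x) ((real k / real N) *\<^sub>R x) = norm x / real N"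
      using N by (simp add: dist_norm scaleR_left_diff_distrib[symmetric] diff_divide_distrib[symmetric])
    also have "\<dots> \<le> 1 / real N"
      using x N by (simp add: divide_right_mono)
    finally have "dist (f ((real (Suc k) / real N) *\<^sub>R x)) (f ((real k / real N) *\<^sub>R x)) < 1"
      using Suc.prems N by (intro d(2) in_ball) auto
    then have "cmod (f ((real (Suc k) / real N) *\<^sub>R x)) \<le> cmod (f ((real k / real N) *\<^sub>R x)) + 1"
      using norm_triangle_ineq2[of "f ((real (Suc k) / real N) *\<^sub>R x)" "f ((real k / real N) *\<^sub>R x)"]
      by (simp only: dist_norm)
    then show ?case using Suc by simp
  qed
  have "cmod (f x) \<le> cmod (f 0) + real N" for x
    using step[of x N] N assms by (cases "x \<in> ball 0 1") (auto simp: Au_set_def)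
  then show ?thesis using that[of "cmod (f 0) + real N"] N by (simp add: add_nonneg_pos)
qed

lemma Au_set_zero: "(\<lambda>_. 0) \<in> Au_set"
  by (auto simp: Au_set_def cholomorphic_on_def bounded_clinear_iff scaleC_complex_def
      intro!: exI[of _ "\<lambda>_. 0"] uniformly_continuous_on_const)

lemma Au_set_one: "(\<lambda>x. if x \<in> ball 0 1 then 1 else 0) \<in> Au_set"
proof -
  have "cholomorphic_on (\<lambda>_::'a. 1) (ball 0 1)"
    by (auto simp: cholomorphic_on_def bounded_clinear_iff scaleC_complex_def intro!: exI[of _ "\<lambda>_. 0"])
  then have "cholomorphic_on (\<lambda>x::'a. if x \<in> ball 0 1 then 1 else 0) (ball 0 1)"
    by (subst cholomorphic_on_cong[of "ball 0 1" _ "\<lambda>_. 1"]) auto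
  moreover have "uniformly_continuous_on (ball 0 1) (\<lambda>x::'a. if x \<in> ball 0 1 then 1 else 0 :: complex)"
    unfolding uniformly_continuous_on_def by (auto intro: exI[of _ 1])
  ultimately show ?thesis
    by (simp add: Au_set_def)
qed

lemma Au_set_add:
  assumes "f \<in> Au_set" "g \<in> Au_set"
  shows "(\<lambda>x. f x + g x) \<in> Au_set"
proof -
  have "cholomorphic_on (\<lambda>x. f x + g x) (ball 0 1)"
    unfolding cholomorphic_on_def
  proof
    fix x :: 'a assume "x \<in> ball 0 1"
    then obtain f' g' where "bounded_clinear f'" "(f has_derivative f') (at x)"
      "bounded_clinear g'" "(g has_derivative g') (at x)"
      using assms unfolding Au_set_def cholomorphic_on_def by blast
    then show "\<exists>h. bounded_clinear h \<and> ((\<lambda>x. f x + g x) has_derivative h) (at x)"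
      by (intro exI[of _ "\<lambda>x. f' x + g' x"])
        (auto simp: bounded_clinear_iff bounded_linear_add scaleC_add_right intro: has_derivative_add)
  qed
  then show ?thesis
    using assms by (auto simp: Au_set_def intro: uniformly_continuous_on_add)
qed

lemma Au_set_mult:
  assumes "f \<in> Au_set" "g \<in> Au_set"
  shows "(\<lambda>x. f x * g x) \<in> Au_set"
proof -
  have "cholomorphic_on (\<lambda>x. f x * g x) (ball 0 1)"
    unfolding cholomorphic_on_def
  proof
    fix x :: 'a assume "x \<in> ball 0 1"
    then obtain f' g' where fg: "bounded_clinear f'" "(f has_derivative f') (at x)"
      "bounded_clinear g'" "(g has_derivative g') (at x)"
      using assms unfolding Au_set_def cholomorphic_on_def by blast
    have "bounded_clinear (\<lambda>h. f x * g' h + f' h * g x)"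
      using fg by (auto simp: bounded_clinear_iff scaleC_complex_def algebra_simps
          intro!: bounded_linear_add bounded_linear_const_mult bounded_linear_mult_const)
    then show "\<exists>h. bounded_clinear h \<and> ((\<lambda>x. f x * g x) has_derivative h) (at x)"
      using has_derivative_mult[OF fg(2,4)] by blast
  qed
  moreover have "uniformly_continuous_on (ball 0 1) (\<lambda>x. f x * g x)"
    unfolding uniformly_continuous_on_def
  proof (intro allI impI)
    fix e :: real assume "e > 0"
    obtain K where K: "K > 0" "\<And>x. cmod (f x) \<le> K" using Au_set_boundedE[OF assms(1)] by metis
    obtain L where L: "L > 0" "\<And>x. cmod (g x) \<le> L" using Au_set_boundedE[OF assms(2)] by metis
    define e' where "e' = e / (K + L)"
    have "K * e' + e' * L = e' * (K + L)" by (simp add: algebra_simps)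
    also have "\<dots> = e" using K L by (simp add: e'_def)
    finally have KL: "K * e' + e' * L = e" .
    have "e' > 0" using \<open>e > 0\<close> K L by (simp add: e'_def)
    then obtain d1 where d1: "d1 > 0" "\<And>x y. x \<in> ball 0 1 \<Longrightarrow> y \<in> ball 0 1 \<Longrightarrow> dist y x < d1 \<Longrightarrow> dist (f y) (f x) < e'"
      using assms(1) unfolding Au_set_def uniformly_continuous_on_def by blast
    obtain d2 where d2: "d2 > 0" "\<And>x y. x \<in> ball 0 1 \<Longrightarrow> y \<in> ball 0 1 \<Longrightarrow> dist y x < d2 \<Longrightarrow> dist (g y) (g x) < e'"
      using assms(2) \<open>e' > 0\<close> unfolding Au_set_def uniformly_continuous_on_def by blast
    have "dist (f y * g y) (f x * g x) < e"
      if "x \<in> ball 0 1" "y \<in> ball 0 1" "dist y x < min d1 d2" for x y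
    proof -
      have "f y * g y - f x * g x = f y * (g y - g x) + (f y - f x) * g x"
        by (simp add: algebra_simps)
      then have "cmod (f y * g y - f x * g x) \<le> cmod (f y) * cmod (g y - g x) + cmod (f y - f x) * cmod (g x)"
        by (metis norm_mult norm_triangle_ineq)
      also have "\<dots> \<le> K * cmod (g y - g x) + cmod (f y - f x) * L"
        by (intro add_mono mult_right_mono mult_left_mono K L) auto
      also have "\<dots> < K * e' + e' * L"
        using d1(2)[of x y] d2(2)[of x y] that K L
        by (intro add_strict_mono mult_strict_left_mono mult_strict_right_mono) (auto simp: dist_norm)
      also have "\<dots> = e"
        by (rule KL)
      finally show ?thesis by (simp add: dist_norm)
    qed
    then show "\<exists>d>0. \<forall>x\<in>ball 0 1. \<forall>y\<in>ball 0 1. dist y x < d \<longrightarrow> dist (f y * g y) (f x * g x) < e"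
      using d1(1) d2(1) by (intro exI[of _ "min d1 d2"]) auto
  qed
  ultimately show ?thesis
    using assms by (auto simp: Au_set_def)
qed

lemma Au_set_cmult:
  assumes "f \<in> Au_set"
  shows "(\<lambda>x. c * f x) \<in> Au_set"
proof -
  have "cholomorphic_on (\<lambda>x. c * f x) (ball 0 1)"
    unfolding cholomorphic_on_def
  proof
    fix x :: 'a assume "x \<in> ball 0 1"
    then obtain f' where "bounded_clinear f'" "(f has_derivative f') (at x)"
      using assms unfolding Au_set_def cholomorphic_on_def by blast
    then show "\<exists>h. bounded_clinear h \<and> ((\<lambda>x. c * f x) has_derivative h) (at x)"
      by (intro exI[of _ "\<lambda>x. c * f' x"])
        (auto simp: bounded_clinear_iff bounded_linear_const_mult scaleC_complex_def
          intro: has_derivative_mult_right)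
  qed
  moreover have "uniformly_continuous_on (ball 0 1) (\<lambda>x. c * f x)"
    using assms bounded_linear.uniformly_continuous_on[OF bounded_linear_mult_right[of c]]
    by (auto simp: Au_set_def)
  ultimately show ?thesis
    using assms by (auto simp: Au_set_def)
qed

lemma Au_set_cdual: "(\<lambda>x. if x \<in> ball 0 1 then cdual_apply f x else 0) \<in> Au_set"
proof -
  have f: "bounded_clinear (cdual_apply f)" using cdual_apply by blast
  have "uniformly_continuous_on (ball 0 1) (cdual_apply f)"
    by (rule bounded_linear.uniformly_continuous_on[OF bounded_clinear_bounded_linear[OF f]])
      (rule uniformly_continuous_on_id)
  then have "uniformly_continuous_on (ball 0 1) (\<lambda>x. if x \<in> ball 0 1 then cdual_apply f x else 0)"
    unfolding uniformly_continuous_on_def by simp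
  moreover have "cholomorphic_on (\<lambda>x. if x \<in> ball 0 1 then cdual_apply f x else 0) (ball 0 1)"
    using cholomorphic_on_clinear[OF f, of "ball 0 1"]
    by (subst cholomorphic_on_cong[of "ball 0 1" _ "cdual_apply f"]) auto
  ultimately show ?thesis
    by (simp add: Au_set_def)
qed

typedef (overloaded) 'a Au = "Au_set :: ('a::complex_normed_vector \<Rightarrow> complex) set"
  morphisms Au_apply Abs_Au
  using Au_set_zero by blast

setup_lifting type_definition_Au

lemma bdd_above_Au: "f \<in> Au_set \<Longrightarrow> bdd_above ((\<lambda>x. cmod (f x)) ` S)"
  by (metis Au_set_boundedE bdd_aboveI2)

instantiation Au :: (complex_normed_vector) "{complex_normed_vector, real_normed_algebra_1, comm_ring_1}"
begin

lift_definition zero_Au :: "'a Au" is "\<lambda>_. 0" by (rule Au_set_zero)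

lift_definition one_Au :: "'a Au" is "\<lambda>x. if x \<in> ball 0 1 then 1 else 0" by (rule Au_set_one)

lift_definition plus_Au :: "'a Au \<Rightarrow> 'a Au \<Rightarrow> 'a Au" is "\<lambda>f g x. f x + g x" by (rule Au_set_add)

lift_definition uminus_Au :: "'a Au \<Rightarrow> 'a Au" is "\<lambda>f x. - f x"
  using Au_set_cmult[of _ "-1"] by simp

lift_definition minus_Au :: "'a Au \<Rightarrow> 'a Au \<Rightarrow> 'a Au" is "\<lambda>f g x. f x - g x"
  using Au_set_add[OF _ Au_set_cmult[of _ "-1"]] by simp

lift_definition times_Au :: "'a Au \<Rightarrow> 'a Au \<Rightarrow> 'a Au" is "\<lambda>f g x. f x * g x" by (rule Au_set_mult)

lift_definition scaleC_Au :: "complex \<Rightarrow> 'a Au \<Rightarrow> 'a Au" is "\<lambda>c f x. c * f x" by (rule Au_set_cmult)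

lift_definition scaleR_Au :: "real \<Rightarrow> 'a Au \<Rightarrow> 'a Au" is "\<lambda>r f x. r *\<^sub>R f x"
  using Au_set_cmult by (simp add: scaleR_conv_of_real)

lift_definition norm_Au :: "'a Au \<Rightarrow> real" is "\<lambda>f. SUP x\<in>ball 0 1. cmod (f x)" .

definition dist_Au :: "'a Au \<Rightarrow> 'a Au \<Rightarrow> real" where
  "dist_Au f g = norm (f - g)"

definition sgn_Au :: "'a Au \<Rightarrow> 'a Au" where
  "sgn_Au f = scaleR (inverse (norm f)) f"

definition uniformity_Au :: "('a Au \<times> 'a Au) filter" where
  "uniformity_Au = (INF e\<in>{0<..}. principal {(x, y). dist x y < e})"

definition open_Au :: "'a Au set \<Rightarrow> bool" where
  "open_Au U = (\<forall>x\<in>U. \<forall>\<^sub>F (x', y) in uniformity. x' = x \<longrightarrow> y \<in> U)"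

instance
proof
  fix f g h :: "'a Au" and r s :: real and c d :: complex
  have b0: "(0::'a) \<in> ball 0 1" and ne: "ball (0::'a) 1 \<noteq> {}" by auto
  show "f + g + h = f + (g + h)" "f + g = g + f" "0 + f = f" "- f + f = 0" "f - g = f + - g"
    "r *\<^sub>R (f + g) = r *\<^sub>R f + r *\<^sub>R g" "(r + s) *\<^sub>R f = r *\<^sub>R f + s *\<^sub>R f"
    "r *\<^sub>R s *\<^sub>R f = (r * s) *\<^sub>R f" "1 *\<^sub>R f = f"
    "c *\<^sub>C (f + g) = c *\<^sub>C f + c *\<^sub>C g" "(c + d) *\<^sub>C f = c *\<^sub>C f + d *\<^sub>C f"
    "c *\<^sub>C d *\<^sub>C f = (c * d) *\<^sub>C f" "complex_of_real r *\<^sub>C f = r *\<^sub>R f"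
    "f * g * h = f * (g * h)" "f * g = g * f" "(f + g) * h = f * h + g * h"
    "f * (g + h) = f * g + f * h"
    "r *\<^sub>R f * g = r *\<^sub>R (f * g)" "f * r *\<^sub>R g = r *\<^sub>R (f * g)"
    by (transfer; simp add: fun_eq_iff algebra_simps scaleR_conv_of_real)+
  show "1 * f = f" "f * 1 = f"
    by (transfer; auto simp: Au_set_def)+
  show "(0 :: 'a Au) \<noteq> 1"
    by transfer (use b0 in \<open>auto simp: fun_eq_iff intro!: exI[of _ 0]\<close>)
  show "dist f g = norm (f - g)" "sgn f = inverse (norm f) *\<^sub>R f"
    by (simp_all add: dist_Au_def sgn_Au_def)
  show "(uniformity :: ('a Au \<times> 'a Au) filter) = (INF e\<in>{0<..}. principal {(x, y). dist x y < e})"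
    by (simp add: uniformity_Au_def)
  show "open U = (\<forall>x\<in>U. \<forall>\<^sub>F (x', y) in uniformity. x' = x \<longrightarrow> y \<in> U)" for U :: "'a Au set"
    by (simp add: open_Au_def)
  have le: "cmod (Au_apply f x) \<le> norm f" if "x \<in> ball 0 1" for f :: "'a Au" and x
    unfolding norm_Au.rep_eq
    by (rule cSUP_upper[OF that bdd_above_Au]) (rule Au_apply)
  have least: "norm f \<le> K" if "\<And>x. x \<in> ball 0 1 \<Longrightarrow> cmod (Au_apply f x) \<le> K" for f :: "'a Au" and K
    unfolding norm_Au.rep_eq by (rule cSUP_least[OF ne that])
  have nonneg: "norm f \<ge> 0" for f :: "'a Au"
    using le[OF b0, of f] norm_ge_zero order_trans by blast
  have norm0: "norm (0 :: 'a Au) = 0"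
    by (rule antisym[OF least nonneg]) (simp add: zero_Au.rep_eq)
  show "(norm f = 0) = (f = 0)"
  proof
    assume *: "norm f = 0"
    have "Au_apply f x = 0" for x
      using le[of x f] * Au_apply[of f] by (cases "x \<in> ball 0 1") (auto simp: Au_set_def)
    then show "f = 0" by (simp add: Au_apply_inject[symmetric] zero_Au.rep_eq fun_eq_iff)
  qed (simp add: norm0)
  show "norm (f + g) \<le> norm f + norm g"
    by (rule least) (metis le plus_Au.rep_eq norm_triangle_mono)
  show "norm (f * g) \<le> norm f * norm g"
    by (rule least) (simp add: times_Au.rep_eq norm_mult mult_mono le nonneg)
  show "norm (1 :: 'a Au) = 1"
    using le[OF b0, of 1] by (intro antisym least) (auto simp: one_Au.rep_eq)
  have cle: "norm (c *\<^sub>C f) \<le> cmod c * norm f" for c and f :: "'a Au"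
    by (rule least) (simp add: scaleC_Au.rep_eq norm_mult mult_left_mono le)
  show C: "norm (c *\<^sub>C f) = cmod c * norm f" for c and f :: "'a Au"
  proof (cases "c = 0")
    case True
    then show ?thesis using cle[of c f] nonneg[of "c *\<^sub>C f"] by simp
  next
    case False
    have "inverse c *\<^sub>C c *\<^sub>C f = f"
      using False by transfer (simp add: fun_eq_iff)
    then have "norm f \<le> norm (c *\<^sub>C f) / cmod c"
      using cle[of "inverse c" "c *\<^sub>C f"] by (simp add: norm_inverse divide_inverse mult.commute)
    then have "cmod c * norm f \<le> norm (c *\<^sub>C f)"
      using False by (simp add: field_simps)
    then show ?thesis using cle[of c f] by simp
  qed
  have "r *\<^sub>R f = complex_of_real r *\<^sub>C f"
    by transfer (simp add: scaleR_conv_of_real)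
  then show "norm (r *\<^sub>R f) = \<bar>r\<bar> * norm f"
    using C[of "complex_of_real r" f] by simp
qed

end

lift_definition cdual_to_Au :: "'a::complex_normed_vector cdual \<Rightarrow> 'a Au" is
  "\<lambda>f x. if x \<in> ball 0 1 then f x else 0"
  subgoal for f
    using Au_set_cdual[of "Abs_cdual f"] Abs_cdual_inverse[of f] by (simp only: mem_Collect_eq)
  done

subsection \<open>Spectrum, fibers and Gleason parts\<close>

definition Au_spectrum :: "('a::complex_normed_vector Au \<Rightarrow> complex) set" where
  "Au_spectrum = {\<phi>. clinear \<phi> \<and> (\<forall>f g. \<phi> (f * g) = \<phi> f * \<phi> g) \<and> (\<exists>f. \<phi> f \<noteq> 0)}"

definition Au_fiber ::
  "'a::complex_normed_vector cdual cdual \<Rightarrow> ('a Au \<Rightarrow> complex) set" where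
  "Au_fiber z = {\<phi> \<in> Au_spectrum. \<forall>f. \<phi> (cdual_to_Au f) = cdual_apply z f}"

text \<open>The supremum is taken in \<^typ>\<open>ereal\<close>, so that it makes sense without first showing
  that characters are bounded.\<close>

definition Au_functional_dist ::
  "('a::complex_normed_vector Au \<Rightarrow> complex) \<Rightarrow> ('a Au \<Rightarrow> complex) \<Rightarrow> ereal" where
  "Au_functional_dist \<phi> \<psi> = (SUP f\<in>{f. norm f \<le> 1}. ereal (cmod (\<phi> f - \<psi> f)))"

definition gleason_part ::
  "('a::complex_normed_vector Au \<Rightarrow> complex) \<Rightarrow> ('a Au \<Rightarrow> complex) set" where
  "gleason_part \<phi> = {\<psi> \<in> Au_spectrum. Au_functional_dist \<phi> \<psi> < 2}"

end

theory Submission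
  imports Defs
begin

text \<open>
  View \<open>z\<close> as a finitely additive measure on \<open>\<nat>\<close> and put \<open>t = 1 - \<parallel>z\<parallel>\<close>. There is a sequence
  \<open>d\<^sub>0 < d\<^sub>1 < \<dots>\<close> whose tails \<open>T\<^sub>M = {d\<^sub>k | k \<ge> M}\<close> have \<open>|z|\<close>-mass at most \<open>2\<^sup>-\<^sup>M\<close>. Finitely supported
  \<open>y\<close> with \<open>\<parallel>y\<parallel> \<le> \<parallel>z\<parallel>\<close> approximate \<open>z\<close>, and adding \<open>s (e\<^sub>i - e\<^sub>j) / 2\<close> with \<open>s\<close> close to \<open>t\<close> and
  \<open>i \<noteq> j\<close> in \<open>T\<^sub>M\<close> hardly changes the values of finitely many functionals, by the pigeonhole principle.
  An independent family of continuum many sets \<open>A\<^sub>X\<close> allows one to prescribe, for every family \<open>S\<close> of indices,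
  that \<open>i\<close> and \<open>j\<close> lie in \<open>A\<^sub>X\<close> for \<open>X \<in> S\<close> and outside \<open>A\<^sub>X\<close> for \<open>X \<notin> S\<close>; compactness then yields a
  character \<open>\<phi>\<^sub>S\<close> in the fiber over \<open>z\<close>.

  A 2-homogeneous polynomial \<open>q\<close> with \<open>|q x| \<le> \<parallel>x|T\<^sub>M\<parallel>\<^sup>2\<close> distinguishes these characters: \<open>\<phi>\<^sub>S q\<close>
  is nearly \<open>t\<^sup>2\<close> or \<open>-t\<^sup>2\<close> according to whether \<open>X \<in> S\<close>. If \<open>u\<close> is a functional of norm at most 1
  that vanishes on \<open>T\<^sub>M\<close> and nearly attains \<open>\<parallel>z\<parallel>\<close>, then a multiple of \<open>u\<^sup>m q\<^sup>n\<close> with \<open>n\<close> odd and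
  \<open>m : 2n\<close> close to \<open>1 - t : t\<close> has norm at most 1 and its values at two different
  characters are close to \<open>w\<close> and \<open>-w\<close> for some \<open>w\<close> of modulus 1, so that their distance is 2.

  Conversely, separability of \<open>\<ell>\<^sub>1\<close> bounds the cardinality of the algebra by the continuum and hence that of the
  spectrum by the cardinality of its power set.
\<close>

subsection \<open>The space \<open>\<ell>\<^sub>1\<close> and its dual\<close>

lemma bounded_clinear_cdual_apply: "bounded_clinear (cdual_apply f)"
  using cdual_apply by blast

lemma bounded_linear_cdual_apply: "bounded_linear (cdual_apply f)"
  by (rule bounded_clinear_bounded_linear[OF bounded_clinear_cdual_apply])

lemmas cdual_apply_add = linear_add[OF bounded_linear.linear[OF bounded_linear_cdual_apply]]
  and cdual_apply_diff = linear_diff[OF bounded_linear.linear[OF bounded_linear_cdual_apply]]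
  and cdual_apply_sum = linear_sum[OF bounded_linear.linear[OF bounded_linear_cdual_apply]]

lemma cdual_apply_scaleC: "cdual_apply f (c *\<^sub>C x) = c * cdual_apply f x"
  using bounded_clinear_cdual_apply[of f] by (simp add: bounded_clinear_iff scaleC_complex_def)

lemma cdual_apply_le: "cmod (cdual_apply f x) \<le> norm f * norm x"
  unfolding norm_cdual.rep_eq by (rule onorm[OF bounded_linear_cdual_apply])

lemma norm_cdual_le:
  assumes "0 \<le> K" "\<And>x. cmod (cdual_apply f x) \<le> K * norm x"
  shows "norm f \<le> K"
  unfolding norm_cdual.rep_eq using assms by (rule onorm_bound)

lemma cdual_eqI: "(\<And>x. cdual_apply f x = cdual_apply g x) \<Longrightarrow> f = g"
  by (simp add: cdual_apply_inject[symmetric] fun_eq_iff)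

section \<open>Unit vectors, coordinate restrictions and series\<close>

lemma summable_norm_l1: "summable (\<lambda>n. cmod (l1_nth x n))"
  using l1_nth by blast

lemma l1_eqI: "(\<And>n. l1_nth x n = l1_nth y n) \<Longrightarrow> x = y"
  by (simp add: l1_nth_inject[symmetric] fun_eq_iff)

lemma l1_nth_sum: "l1_nth (\<Sum>i\<in>I. x i) n = (\<Sum>i\<in>I. l1_nth (x i) n)"
  by (induction I rule: infinite_finite_induct) (simp_all add: zero_l1.rep_eq plus_l1.rep_eq)

lift_definition l1_unit :: "nat \<Rightarrow> l1" is "\<lambda>k n. if n = k then 1 else 0"
  by (rule summable_finite[of "{_}"]) auto

lemma norm_l1_unit [simp]: "norm (l1_unit k) = 1"
proof -
  have "(\<Sum>n. cmod (if n = k then 1 else 0)) = (\<Sum>n\<in>{k}. cmod (if n = k then 1 else 0))"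
    by (rule suminf_finite) auto
  then show ?thesis by transfer simp
qed

lift_definition l1_restrict :: "nat set \<Rightarrow> l1 \<Rightarrow> l1" is "\<lambda>D x n. if n \<in> D then x n else 0"
  by (erule summable_comparison_test'[where N = 0]) auto

lemma l1_restrict_UNIV [simp]: "l1_restrict UNIV x = x"
  by transfer simp

lemma l1_restrict_sum: "l1_restrict D (\<Sum>i\<in>I. x i) = (\<Sum>i\<in>I. l1_restrict D (x i))"
  by (rule l1_eqI) (simp add: l1_restrict.rep_eq l1_nth_sum)

lemma l1_restrict_scaleC: "l1_restrict D (c *\<^sub>C x) = c *\<^sub>C l1_restrict D x"
  by transfer auto

lemma l1_restrict_unit: "l1_restrict D (l1_unit k) = (if k \<in> D then l1_unit k else 0)"
  by (rule l1_eqI) (auto simp: l1_restrict.rep_eq l1_unit.rep_eq zero_l1.rep_eq)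

lemma norm_l1_restrict_Compl: "norm (l1_restrict D x) + norm (l1_restrict (- D) x) = norm x"
proof -
  have "(\<lambda>n. cmod (l1_nth (l1_restrict D x) n) + cmod (l1_nth (l1_restrict (- D) x) n))
      = (\<lambda>n. cmod (l1_nth x n))"
    by (auto simp: l1_restrict.rep_eq)
  then show ?thesis
    using suminf_add[OF summable_norm_l1[of "l1_restrict D x"] summable_norm_l1[of "l1_restrict (- D) x"]]
    by (simp add: norm_l1.rep_eq)
qed

text \<open>The norm of the remainder is a tail of the convergent series of moduli. Hence the unit
  vectors determine every functional.\<close>

lemma l1_sums: "(\<lambda>n. l1_nth x n *\<^sub>C l1_unit n) sums x"
proof -
  have "norm ((\<Sum>n<N. l1_nth x n *\<^sub>C l1_unit n) - x) = (\<Sum>n. cmod (l1_nth x n)) - (\<Sum>n<N. cmod (l1_nth x n))"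
    for N
  proof -
    have "l1_nth ((\<Sum>n<N. l1_nth x n *\<^sub>C l1_unit n) - x) = (\<lambda>k. if k < N then 0 else - l1_nth x k)"
      by (auto simp: fun_eq_iff minus_l1.rep_eq l1_nth_sum scaleC_l1.rep_eq l1_unit.rep_eq if_distrib cong: if_cong)
    then have eq: "norm ((\<Sum>n<N. l1_nth x n *\<^sub>C l1_unit n) - x) = (\<Sum>k. if k < N then 0 else cmod (l1_nth x k))"
      by (simp add: norm_l1.rep_eq if_distrib cong: if_cong)
    have "summable (\<lambda>k. if k < N then 0 else cmod (l1_nth x k))"
      by (rule summable_comparison_test'[OF summable_norm_l1[of x], of 0]) auto
    from suminf_split_initial_segment[OF this, of N]
    have "(\<Sum>k. if k < N then 0 else cmod (l1_nth x k)) = (\<Sum>k. cmod (l1_nth x (k + N)))"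
      by simp
    then show ?thesis
      using suminf_split_initial_segment[OF summable_norm_l1, of x N] eq by simp
  qed
  moreover have "(\<lambda>N. (\<Sum>n. cmod (l1_nth x n)) - (\<Sum>n<N. cmod (l1_nth x n))) \<longlonglongrightarrow> 0"
    using tendsto_diff[OF tendsto_const summable_LIMSEQ[OF summable_norm_l1[of x]],
        of "\<Sum>n. cmod (l1_nth x n)"] by simp
  ultimately show ?thesis
    unfolding sums_def by (subst tendsto_dist_iff) (simp add: dist_norm)
qed

text \<open>The identification of bounded sequences with the dual of \<open>l1\<close>.
  \<open>Abs_cdual\<close> is meaningful only for bounded \<open>b\<close>, hence the boundedness
  hypotheses below.\<close>

definition linf_dual :: "(nat \<Rightarrow> complex) \<Rightarrow> l1 cdual" where
  "linf_dual b = Abs_cdual (\<lambda>x. \<Sum>n. b n * l1_nth x n)"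

lemma summable_linf_dual:
  assumes "bounded (range b)"
  shows "summable (\<lambda>n. cmod (b n * l1_nth x n))"
proof -
  obtain K where "\<And>n. cmod (b n) \<le> K"
    using assms by (auto simp: bounded_iff)
  then show ?thesis
    by (intro summable_comparison_test'[OF summable_mult[OF summable_norm_l1[of x], of K], of 0])
      (simp add: norm_mult mult_right_mono)
qed

lemma linf_dual_bound:
  assumes "\<And>n. cmod (b n) \<le> K"
  shows "cmod (\<Sum>n. b n * l1_nth x n) \<le> K * norm x"
proof -
  have b: "bounded (range b)" using assms by (auto simp: bounded_iff)
  have "cmod (\<Sum>n. b n * l1_nth x n) \<le> (\<Sum>n. cmod (b n * l1_nth x n))"
    by (rule summable_norm[OF summable_linf_dual[OF b]])
  also have "\<dots> \<le> (\<Sum>n. K * cmod (l1_nth x n))"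
    by (rule suminf_le[OF _ summable_linf_dual[OF b] summable_mult[OF summable_norm_l1]])
      (simp add: norm_mult mult_right_mono assms)
  also have "\<dots> = K * norm x"
    by (simp add: suminf_mult[OF summable_norm_l1] norm_l1.rep_eq)
  finally show ?thesis .
qed

lemma linf_dual_apply:
  assumes "bounded (range b)"
  shows "cdual_apply (linf_dual b) x = (\<Sum>n. b n * l1_nth x n)"
proof -
  obtain K where K: "\<And>n. cmod (b n) \<le> K"
    using assms by (auto simp: bounded_iff)
  note sm = summable_norm_cancel[OF summable_linf_dual[OF assms]]
  have "bounded_clinear (\<lambda>x. \<Sum>n. b n * l1_nth x n)"
    unfolding bounded_clinear_def clinear_def
  proof (intro conjI allI exI)
    show "(\<Sum>n. b n * l1_nth (x + y) n) = (\<Sum>n. b n * l1_nth x n) + (\<Sum>n. b n * l1_nth y n)" for x y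
      by (simp add: suminf_add[OF sm sm] plus_l1.rep_eq algebra_simps)
    show "(\<Sum>n. b n * l1_nth (c *\<^sub>C x) n) = c *\<^sub>C (\<Sum>n. b n * l1_nth x n)" for c x
      by (simp add: suminf_mult[OF sm] scaleC_l1.rep_eq scaleC_complex_def mult.left_commute)
    show "cmod (\<Sum>n. b n * l1_nth x n) \<le> K * norm x" for x
      by (rule linf_dual_bound[OF K])
  qed
  then show ?thesis
    by (simp add: linf_dual_def Abs_cdual_inverse)
qed

lemma norm_linf_dual_le:
  assumes "\<And>n. cmod (b n) \<le> K"
  shows "norm (linf_dual b) \<le> K"
proof (rule norm_cdual_le)
  show "0 \<le> K" using assms[of 0] norm_ge_zero order_trans by blast
  have "bounded (range b)" using assms by (auto simp: bounded_iff)
  then show "cmod (cdual_apply (linf_dual b) x) \<le> K * norm x" for x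
    by (simp add: linf_dual_apply linf_dual_bound[OF assms])
qed

lemma linf_dual_unit:
  assumes "bounded (range b)"
  shows "cdual_apply (linf_dual b) (l1_unit k) = b k"
proof -
  have "(\<Sum>n. b n * (if n = k then 1 else 0)) = (\<Sum>n\<in>{k}. b n * (if n = k then 1 else 0))"
    by (rule suminf_finite) auto
  then show ?thesis
    by (simp add: linf_dual_apply[OF assms] l1_unit.rep_eq)
qed

lemma cmod_cdual_unit_le: "cmod (cdual_apply f (l1_unit n)) \<le> norm f"
  using cdual_apply_le[of f "l1_unit n"] by simp

lemma bounded_cdual_unit: "bounded (range (\<lambda>n. cdual_apply f (l1_unit n)))"
  using cmod_cdual_unit_le[of f] by (auto simp: bounded_iff)

lemma cdual_l1_eqI:
  assumes "\<And>n. cdual_apply f (l1_unit n) = cdual_apply g (l1_unit n)"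
  shows "f = g"
proof (rule cdual_eqI)
  have *: "(\<lambda>n. l1_nth x n * cdual_apply h (l1_unit n)) sums cdual_apply h x" for h x
    using bounded_linear.sums[OF bounded_linear_cdual_apply l1_sums, of h x]
    by (simp only: cdual_apply_scaleC)
  show "cdual_apply f x = cdual_apply g x" for x
    using sums_unique2[OF *[of x f]] *[of x g] assms by simp
qed

lemma linf_dual_cdual: "linf_dual (\<lambda>n. cdual_apply f (l1_unit n)) = f"
  by (rule cdual_l1_eqI) (rule linf_dual_unit[OF bounded_cdual_unit])

lemma bounded_range_plus:
  assumes "bounded (range b)" "bounded (range (c :: nat \<Rightarrow> complex))"
  shows "bounded (range (\<lambda>n. b n + c n))"
  by (rule bounded_plus_comp[OF assms])

lemma bounded_range_mult:
  "bounded (range (b :: nat \<Rightarrow> complex)) \<Longrightarrow> bounded (range (\<lambda>n. w * b n))"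
  using bounded_linear_image[OF _ bounded_linear_mult_right, of "range b" w] by (simp add: image_image)

lemma linf_dual_add:
  assumes "bounded (range b)" "bounded (range c)"
  shows "linf_dual (\<lambda>n. b n + c n) = linf_dual b + linf_dual c"
  by (rule cdual_l1_eqI)
    (simp add: linf_dual_unit bounded_range_plus assms plus_cdual.rep_eq)

lemma linf_dual_mult:
  assumes "bounded (range b)"
  shows "linf_dual (\<lambda>n. w * b n) = w *\<^sub>C linf_dual b"
  by (rule cdual_l1_eqI)
    (simp add: linf_dual_unit bounded_range_mult assms scaleC_cdual.rep_eq)

lemma linf_dual_diff:
  assumes "bounded (range b)" "bounded (range c)"
  shows "linf_dual (\<lambda>n. b n - c n) = linf_dual b - linf_dual c"
  by (rule cdual_l1_eqI)
    (simp add: linf_dual_unit bounded_minus_comp assms minus_cdual.rep_eq)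

lemma bounded_range_sum:
  assumes "\<And>i. i \<in> I \<Longrightarrow> bounded (range (b i :: nat \<Rightarrow> complex))"
  shows "bounded (range (\<lambda>n. \<Sum>i\<in>I. b i n))"
  using assms by (induction I rule: infinite_finite_induct) (auto intro: bounded_plus_comp)

lemma cdual_sum_apply: "cdual_apply (\<Sum>i\<in>I. f i) x = (\<Sum>i\<in>I. cdual_apply (f i) x)"
  by (induction I rule: infinite_finite_induct) (simp_all add: zero_cdual.rep_eq plus_cdual.rep_eq)

lemma linf_dual_sum:
  assumes "\<And>i. i \<in> I \<Longrightarrow> bounded (range (b i))"
  shows "linf_dual (\<lambda>n. \<Sum>i\<in>I. b i n) = (\<Sum>i\<in>I. linf_dual (b i))"
  by (rule cdual_l1_eqI)
    (simp add: linf_dual_unit bounded_range_sum assms cdual_sum_apply)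

subsection \<open>Mass and approximation of functionals on the dual\<close>

text \<open>The total variation of \<open>z\<close>, seen as a finitely additive measure on the natural numbers,
  is at most \<open>\<eta>\<close> on \<open>D\<close>.\<close>

definition mass_le :: "l1 cdual cdual \<Rightarrow> nat set \<Rightarrow> real \<Rightarrow> bool" where
  "mass_le z D \<eta> \<longleftrightarrow> (\<forall>b. (\<forall>n. cmod (b n) \<le> 1) \<longrightarrow> (\<forall>n. n \<notin> D \<longrightarrow> b n = 0) \<longrightarrow>
     cmod (cdual_apply z (linf_dual b)) \<le> \<eta>)"

lemma mass_leD:
  assumes "mass_le z D \<eta>" "\<And>n. cmod (b n) \<le> 1" "\<And>n. n \<notin> D \<Longrightarrow> b n = 0"
  shows "cmod (cdual_apply z (linf_dual b)) \<le> \<eta>"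
  using assms unfolding mass_le_def by blast

lemma mass_le_subset: "mass_le z D \<eta> \<Longrightarrow> E \<subseteq> D \<Longrightarrow> \<eta> \<le> \<eta>' \<Longrightarrow> mass_le z E \<eta>'"
  unfolding mass_le_def by (meson order_trans subset_iff)

lemma mass_le_UNIV: "mass_le z UNIV (norm z)"
  unfolding mass_le_def
proof (intro allI impI)
  fix b :: "nat \<Rightarrow> complex" assume "\<forall>n. cmod (b n) \<le> 1"
  then have "norm (linf_dual b) \<le> 1" by (intro norm_linf_dual_le) auto
  then have "norm z * norm (linf_dual b) \<le> norm z * 1" by (intro mult_left_mono) auto
  then show "cmod (cdual_apply z (linf_dual b)) \<le> norm z"
    using cdual_apply_le[of z "linf_dual b"] by linarith
qed

lemma rotate_to_cmod: obtains w where "cmod w = 1" "w * c = complex_of_real (cmod c)"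
proof (cases "c = 0")
  case False
  then have "cmod (cnj c / cmod c) = 1" by (simp add: norm_divide)
  moreover have "cnj c / cmod c * c = complex_of_real (cmod c)"
    using False by (simp add: complex_norm_square[symmetric] mult.commute power2_eq_square)
  ultimately show ?thesis by (rule that)
qed (use that[of 1] in simp)

text \<open>Total variation is additive on disjoint sets: if each part had a witness above
  \<open>\<eta> / 2\<close>, rotating both values onto the positive axis and adding the witnesses
  would exceed \<open>\<eta>\<close> on the union.\<close>

lemma mass_le_halves:
  assumes "mass_le z (D \<union> E) \<eta>" "D \<inter> E = {}"
  shows "mass_le z D (\<eta> / 2) \<or> mass_le z E (\<eta> / 2)"
proof (rule ccontr)
  assume "\<not> ?thesis"
  then obtain b c where
    b: "\<And>n. cmod (b n) \<le> 1" "\<And>n. n \<notin> D \<Longrightarrow> b n = 0" "\<eta> / 2 < cmod (cdual_apply z (linf_dual b))" and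
    c: "\<And>n. cmod (c n) \<le> 1" "\<And>n. n \<notin> E \<Longrightarrow> c n = 0" "\<eta> / 2 < cmod (cdual_apply z (linf_dual c))"
    unfolding mass_le_def by (auto simp: not_le)
  have bdd: "bounded (range b)" "bounded (range c)" using b c by (auto simp: bounded_iff)
  obtain v where v: "cmod v = 1" "v * cdual_apply z (linf_dual b) = cmod (cdual_apply z (linf_dual b))"
    by (rule rotate_to_cmod)
  obtain w where w: "cmod w = 1" "w * cdual_apply z (linf_dual c) = cmod (cdual_apply z (linf_dual c))"
    by (rule rotate_to_cmod)
  have "cmod (cdual_apply z (linf_dual (\<lambda>n. v * b n + w * c n))) \<le> \<eta>"
  proof (rule mass_leD[OF assms(1)])
    show "cmod (v * b n + w * c n) \<le> 1" for n
    proof (cases "n \<in> D")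
      case True
      then have "c n = 0" using c assms(2) by blast
      then show ?thesis using b v by (simp add: norm_mult)
    next
      case False
      then show ?thesis using b c w by (simp add: norm_mult)
    qed
  qed (use b c in auto)
  also have "cdual_apply z (linf_dual (\<lambda>n. v * b n + w * c n))
      = v * cdual_apply z (linf_dual b) + w * cdual_apply z (linf_dual c)"
    by (simp add: linf_dual_add linf_dual_mult bounded_range_mult bdd cdual_apply_add cdual_apply_scaleC)
  also have "cmod \<dots> = cmod (cdual_apply z (linf_dual b)) + cmod (cdual_apply z (linf_dual c))"
    unfolding v w by (metis abs_of_nonneg add_nonneg_nonneg norm_ge_zero norm_of_real of_real_add)
  finally show False using b c by linarith
qed

lemma infinite_split:
  assumes "infinite (D :: nat set)"
  obtains E where "E \<subseteq> D" "infinite E" "infinite (D - E)"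
proof
  let ?e = "enumerate D"
  have inj: "?e m = ?e n \<longleftrightarrow> m = n" for m n
    using strict_mono_eq[OF strict_mono_enumerate[OF assms]] .
  have e: "?e n \<in> D" for n using assms enumerate_in_set by blast
  show "range (\<lambda>n. ?e (2 * n)) \<subseteq> D" using e by auto
  show "infinite (range (\<lambda>n. ?e (2 * n)))"
    by (rule range_inj_infinite) (simp add: inj_def inj)
  have "range (\<lambda>n. ?e (Suc (2 * n))) \<subseteq> D - range (\<lambda>n. ?e (2 * n))"
  proof
    fix x assume "x \<in> range (\<lambda>n. ?e (Suc (2 * n)))"
    then obtain n where x: "x = ?e (Suc (2 * n))" by blast
    have "Suc (2 * n) \<noteq> 2 * m" for m by presburger
    then show "x \<in> D - range (\<lambda>n. ?e (2 * n))"
      using e x inj by auto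
  qed
  moreover have "infinite (range (\<lambda>n. ?e (Suc (2 * n))))"
    by (rule range_inj_infinite) (simp add: inj_def inj)
  ultimately show "infinite (D - range (\<lambda>n. ?e (2 * n)))"
    using finite_subset by blast
qed

text \<open>An infinite set is split into two infinite parts, and one with at most half of the mass
  bound is kept. Repetition gives nested sets, and \<open>d\<close> picks increasing points, one
  from each.\<close>

lemma exists_thin_sequence:
  "\<exists>d :: nat \<Rightarrow> nat. strict_mono d \<and> (\<forall>M. mass_le z (d ` {M..}) (norm z / 2 ^ M))"
proof -
  define P where "P = (\<lambda>n (D, k). infinite D \<and> k \<in> D \<and> mass_le z D (norm z / 2 ^ n))"
  define Q where "Q = (\<lambda>(n::nat) (D, k::nat) (D', k'). D' \<subseteq> (D :: nat set) \<and> k < k')"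
  have "\<exists>f. \<forall>n. P n (f n) \<and> Q n (f n) (f (Suc n))"
  proof (rule dependent_nat_choice)
    show "\<exists>x. P 0 x"
      by (rule exI[of _ "(UNIV, 0)"]) (simp add: P_def mass_le_UNIV)
  next
    fix x n assume "P n x"
    then obtain D k where x: "x = (D, k)" "infinite D" "mass_le z D (norm z / 2 ^ n)"
      by (auto simp: P_def)
    obtain E where E: "E \<subseteq> D" "infinite E" "infinite (D - E)"
      using infinite_split[OF x(2)] by blast
    have "mass_le z E (norm z / 2 ^ n / 2) \<or> mass_le z (D - E) (norm z / 2 ^ n / 2)"
      using E(1) x(3) by (intro mass_le_halves) (auto simp: Un_absorb1)
    then obtain D' where D': "D' \<subseteq> D" "infinite D'" "mass_le z D' (norm z / 2 ^ Suc n)"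
      using E by (auto simp: field_simps)
    obtain k' where "k' \<in> D'" "k < k'"
      using D'(2) by (metis infinite_nat_iff_unbounded)
    then show "\<exists>y. P (Suc n) y \<and> Q n x y"
      using D' x by (intro exI[of _ "(D', k')"]) (simp add: P_def Q_def)
  qed
  then obtain f where f: "\<And>n. P n (f n)" "\<And>n. Q n (f n) (f (Suc n))" by blast
  define d where "d = snd \<circ> f"
  \<comment> \<open>By nestedness, all points chosen from stage \<open>M\<close> on lie in the
    \<open>M\<close>-th set.\<close>
  have "decseq (fst \<circ> f)"
  proof (rule decseq_SucI)
    show "(fst \<circ> f) (Suc n) \<subseteq> (fst \<circ> f) n" for n
      using f(2)[of n] by (auto simp: Q_def split: prod.splits)
  qed
  moreover have "d k \<in> fst (f k)" for k
    using f(1)[of k] by (auto simp: P_def d_def split: prod.splits)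
  ultimately have "d ` {M..} \<subseteq> fst (f M)" for M
    using decseqD by fastforce
  moreover have "mass_le z (fst (f M)) (norm z / 2 ^ M)" for M
    using f(1)[of M] by (auto simp: P_def split: prod.splits)
  ultimately have "mass_le z (d ` {M..}) (norm z / 2 ^ M)" for M
    using mass_le_subset by blast
  moreover have "d n < d (Suc n)" for n
    using f(2)[of n] by (auto simp: d_def Q_def split: prod.splits)
  then have "strict_mono d" by (simp add: strict_mono_Suc_iff)
  ultimately show ?thesis by blast
qed

text \<open>Bounded ranges are totally bounded. The label of \<open>n\<close> lists, for each
  \<open>b\<close> in \<open>B\<close>, a point near \<open>b n\<close> of a finite
  \<open>\<epsilon> / 2\<close>-net.\<close>

lemma exists_labelling:
  assumes "finite B" "\<And>b. b \<in> B \<Longrightarrow> bounded (range b)" "\<epsilon> > 0"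
  shows "\<exists>\<pi> :: nat \<Rightarrow> complex list. finite (range \<pi>) \<and>
    (\<forall>b\<in>B. \<forall>m n. \<pi> m = \<pi> n \<longrightarrow> cmod (b m - b n) \<le> \<epsilon>)"
  using assms(1,2)
proof (induction B rule: finite_induct)
  case empty
  show ?case by (rule exI[of _ "\<lambda>_. []"]) auto
next
  case (insert b B)
  then obtain \<pi> :: "nat \<Rightarrow> complex list" where \<pi>: "finite (range \<pi>)"
    "\<And>c m n. c \<in> B \<Longrightarrow> \<pi> m = \<pi> n \<Longrightarrow> cmod (c m - c n) \<le> \<epsilon>" by auto
  have "compact (closure (range b))"
    using insert.prems by (simp add: compact_closure)
  then obtain K where K: "finite K" "closure (range b) \<subseteq> (\<Union>x\<in>K. ball x (\<epsilon> / 2))"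
    using \<open>\<epsilon> > 0\<close> unfolding compact_eq_totally_bounded by (meson half_gt_zero)
  then have "\<forall>n. \<exists>x\<in>K. dist x (b n) < \<epsilon> / 2"
    using closure_subset[of "range b"] by (auto simp: subset_iff)
  then obtain g where g: "\<And>n. g n \<in> K" "\<And>n. dist (g n) (b n) < \<epsilon> / 2" by metis
  have "range (\<lambda>n. g n # \<pi> n) \<subseteq> (\<lambda>(x, l). x # l) ` (K \<times> range \<pi>)"
    using g by auto
  then have "finite (range (\<lambda>n. g n # \<pi> n))"
    by (rule finite_subset) (use K \<pi> in auto)
  moreover have "cmod (b m - b n) \<le> \<epsilon>" if "g m = g n" for m n
  proof -
    have "dist (b m) (b n) < \<epsilon> / 2 + \<epsilon> / 2"
      using g(2)[of m] g(2)[of n] that by (metis dist_commute dist_triangle_half_l field_sum_of_halves)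
    then show ?thesis by (simp add: dist_norm)
  qed
  ultimately show ?case
    using \<pi> by (intro exI[of _ "\<lambda>n. g n # \<pi> n"]) auto
qed

text \<open>The vector \<open>y\<close> concentrates the \<open>z\<close>-measure of each class of \<open>\<pi>\<close> in one of its points.\<close>

lemma exists_l1_approx:
  fixes z :: "l1 cdual cdual" and \<pi> :: "nat \<Rightarrow> 'k"
  assumes fin: "finite (range \<pi>)"
  obtains y where
    "\<And>b \<epsilon>. bounded (range b) \<Longrightarrow> (\<And>m n. \<pi> m = \<pi> n \<Longrightarrow> cmod (b m - b n) \<le> \<epsilon>) \<Longrightarrow>
      cmod (cdual_apply (linf_dual b) y - cdual_apply z (linf_dual b)) \<le> \<epsilon> * norm z"
    "\<And>D \<eta>. mass_le z D \<eta> \<Longrightarrow> (\<And>m n. \<pi> m = \<pi> n \<Longrightarrow> m \<in> D \<Longrightarrow> n \<in> D) \<Longrightarrow> norm (l1_restrict D y) \<le> \<eta>"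
proof -
  \<comment> \<open>\<open>r l\<close> is the point meant to carry the measure of the class with
    label \<open>l\<close>; that measure is \<open>Z l\<close> below.\<close>
  define r where "r l = (SOME n. \<pi> n = l)" for l
  have r: "\<pi> (r (\<pi> n)) = \<pi> n" for n
    unfolding r_def by (rule someI) simp
  define ind where "ind l n = (if \<pi> n = l then 1 else 0 :: complex)" for l n
  have ind: "bounded (range (ind l))" for l
    by (auto simp: bounded_iff ind_def intro!: exI[of _ 1])
  define Z where "Z l = cdual_apply z (linf_dual (ind l))" for l
  have sumZ: "cdual_apply z (linf_dual (\<lambda>n. \<Sum>l\<in>L. c l * ind l n)) = (\<Sum>l\<in>L. c l * Z l)" for L and c
    by (simp add: linf_dual_sum bounded_range_mult ind linf_dual_mult cdual_apply_sum cdual_apply_scaleC Z_def)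
  define y where "y = (\<Sum>l\<in>range \<pi>. Z l *\<^sub>C l1_unit (r l))"
  show ?thesis
  proof (rule that[of y])
    fix b \<epsilon> assume b: "bounded (range b)" and osc: "\<And>m n. \<pi> m = \<pi> n \<Longrightarrow> cmod (b m - b n) \<le> \<epsilon>"
    \<comment> \<open>Applying \<open>b\<close> to \<open>y\<close> amounts to applying
      \<open>z\<close> to the sequence that replaces \<open>b\<close> on each class by its value at
      the representative.\<close>
    have "(\<Sum>l\<in>range \<pi>. b (r l) * ind l n) = b (r (\<pi> n))" for n
      using fin by (simp add: ind_def if_distrib[of "\<lambda>x. _ * x"] sum.delta' cong: if_cong)
    then have "cdual_apply (linf_dual b) y = cdual_apply z (linf_dual (\<lambda>n. b (r (\<pi> n))))"
      using sumZ[of "\<lambda>l. b (r l)" "range \<pi>"]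
      by (simp add: y_def cdual_apply_sum cdual_apply_scaleC linf_dual_unit b mult.commute)
    moreover have "bounded (range (\<lambda>n. b (r (\<pi> n))))"
      by (rule bounded_subset[OF b]) auto
    ultimately have "cdual_apply (linf_dual b) y - cdual_apply z (linf_dual b)
        = cdual_apply z (linf_dual (\<lambda>n. b (r (\<pi> n)) - b n))"
      by (simp add: linf_dual_diff b cdual_apply_diff)
    moreover have "norm (linf_dual (\<lambda>n. b (r (\<pi> n)) - b n)) \<le> \<epsilon>"
      by (rule norm_linf_dual_le) (simp add: osc r)
    then have "norm z * norm (linf_dual (\<lambda>n. b (r (\<pi> n)) - b n)) \<le> \<epsilon> * norm z"
      by (subst mult.commute) (rule mult_right_mono, auto)
    ultimately show "cmod (cdual_apply (linf_dual b) y - cdual_apply z (linf_dual b)) \<le> \<epsilon> * norm z"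
      using cdual_apply_le order_trans by metis
  next
    fix D \<eta> assume D: "mass_le z D \<eta>" and sat: "\<And>m n. \<pi> m = \<pi> n \<Longrightarrow> m \<in> D \<Longrightarrow> n \<in> D"
    define L where "L = {l \<in> range \<pi>. r l \<in> D}"
    have "finite L" using fin by (simp add: L_def)
    \<comment> \<open>The phases \<open>w l\<close> turn the sum of the moduli of \<open>Z l\<close>
      into the value of \<open>z\<close> at a sequence of modulus at most 1. As \<open>D\<close> is
      a union of classes, this sequence vanishes off \<open>D\<close>.\<close>
    have "\<exists>w. cmod w = 1 \<and> w * Z l = complex_of_real (cmod (Z l))" for l
      using rotate_to_cmod by metis
    then obtain w where w: "\<And>l. cmod (w l) = 1" "\<And>l. w l * Z l = complex_of_real (cmod (Z l))"
      by metis
    have "l1_restrict D y = (\<Sum>l\<in>range \<pi>. if r l \<in> D then Z l *\<^sub>C l1_unit (r l) else 0)"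
      unfolding y_def l1_restrict_sum l1_restrict_scaleC l1_restrict_unit
      by (rule sum.cong) (auto simp: zero_l1.rep_eq scaleC_l1.rep_eq intro!: l1_eqI)
    also have "\<dots> = (\<Sum>l\<in>L. Z l *\<^sub>C l1_unit (r l))"
      using fin unfolding L_def by (simp add: sum.If_cases Int_def)
    also have "norm \<dots> \<le> (\<Sum>l\<in>L. cmod (Z l))"
      by (rule order_trans[OF norm_sum]) (simp add: norm_scaleC)
    also have "\<dots> = cmod (\<Sum>l\<in>L. w l * Z l)"
    proof -
      have "(\<Sum>l\<in>L. w l * Z l) = complex_of_real (\<Sum>l\<in>L. cmod (Z l))"
        by (simp add: w)
      then show ?thesis by (simp only: norm_of_real abs_of_nonneg[OF sum_nonneg] norm_ge_zero)
    qed
    also have "\<dots> = cmod (cdual_apply z (linf_dual (\<lambda>n. \<Sum>l\<in>L. w l * ind l n)))"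
      by (simp add: sumZ)
    also have "\<dots> \<le> \<eta>"
    proof (rule mass_leD[OF D])
      have eq: "(\<Sum>l\<in>L. w l * ind l n) = (if \<pi> n \<in> L then w (\<pi> n) else 0)" for n
        using \<open>finite L\<close> by (simp add: ind_def if_distrib[of "\<lambda>x. _ * x"] sum.delta' cong: if_cong)
      show "cmod (\<Sum>l\<in>L. w l * ind l n) \<le> 1" for n
        by (simp add: eq w)
      show "(\<Sum>l\<in>L. w l * ind l n) = 0" if "n \<notin> D" for n
      proof -
        have "\<pi> n \<notin> L" using that sat[OF r] by (auto simp: L_def)
        then show ?thesis by (simp add: eq)
      qed
    qed
    finally show "norm (l1_restrict D y) \<le> \<eta>" .
  qed
qed

subsection \<open>Separating polynomials and the independent family\<close>

text \<open>The bilinear form \<open>\<Sum>i j. a i j * x\<^sub>i * y\<^sub>j\<close>, written as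
  two nested functionals so that convergence and bounds come from \<open>linf_dual\<close>.\<close>

definition matrix_form :: "(nat \<Rightarrow> nat \<Rightarrow> complex) \<Rightarrow> l1 \<Rightarrow> l1 \<Rightarrow> complex" where
  "matrix_form a x y = cdual_apply (linf_dual (\<lambda>i. cdual_apply (linf_dual (a i)) y)) x"

context
  fixes a :: "nat \<Rightarrow> nat \<Rightarrow> complex"
  assumes le1: "\<And>i j. cmod (a i j) \<le> 1"
begin

lemma matrix_row_bounded: "bounded (range (a i))"
  using le1 by (auto simp: bounded_iff)

lemma matrix_row_le: "cmod (cdual_apply (linf_dual (a i)) y) \<le> norm y"
proof -
  have "norm (linf_dual (a i)) \<le> 1" by (rule norm_linf_dual_le) (rule le1)
  then have "norm (linf_dual (a i)) * norm y \<le> 1 * norm y" by (rule mult_right_mono) simp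
  then show ?thesis using cdual_apply_le[of "linf_dual (a i)" y] by linarith
qed

lemma matrix_column_bounded: "bounded (range (\<lambda>i. cdual_apply (linf_dual (a i)) y))"
  using matrix_row_le[of _ y] by (auto simp: bounded_iff)

lemma matrix_form_le: "cmod (matrix_form a x y) \<le> norm x * norm y"
proof -
  have "norm (linf_dual (\<lambda>i. cdual_apply (linf_dual (a i)) y)) \<le> norm y"
    by (rule norm_linf_dual_le) (rule matrix_row_le)
  then have "norm (linf_dual (\<lambda>i. cdual_apply (linf_dual (a i)) y)) * norm x \<le> norm y * norm x"
    by (rule mult_right_mono) simp
  then show ?thesis
    using cdual_apply_le[of "linf_dual (\<lambda>i. cdual_apply (linf_dual (a i)) y)" x]
    by (simp add: matrix_form_def mult.commute)
qed

lemma matrix_form_add_left: "matrix_form a (x + x') y = matrix_form a x y + matrix_form a x' y"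
  by (simp add: matrix_form_def cdual_apply_add)

lemma matrix_form_scaleC_left: "matrix_form a (c *\<^sub>C x) y = c * matrix_form a x y"
  by (simp add: matrix_form_def cdual_apply_scaleC)

lemma matrix_form_add_right: "matrix_form a x (y + y') = matrix_form a x y + matrix_form a x y'"
  by (simp add: matrix_form_def cdual_apply_add linf_dual_add matrix_column_bounded plus_cdual.rep_eq)

lemma matrix_form_scaleC_right: "matrix_form a x (c *\<^sub>C y) = c * matrix_form a x y"
  by (simp add: matrix_form_def cdual_apply_scaleC linf_dual_mult matrix_column_bounded scaleC_cdual.rep_eq)

lemma matrix_form_unit: "matrix_form a (l1_unit i) (l1_unit j) = a i j"
  unfolding matrix_form_def linf_dual_unit[OF matrix_row_bounded]
  by (rule linf_dual_unit) (use le1 in \<open>auto simp: bounded_iff\<close>)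

lemma bounded_bilinear_matrix_form: "bounded_bilinear (matrix_form a)"
proof
  show "matrix_form a (r *\<^sub>R x) y = r *\<^sub>R matrix_form a x y" for r x y
    by (simp only: scaleC_of_real[symmetric] matrix_form_scaleC_left) (simp add: scaleC_complex_def)
  show "matrix_form a x (r *\<^sub>R y) = r *\<^sub>R matrix_form a x y" for r x y
    by (simp only: scaleC_of_real[symmetric] matrix_form_scaleC_right) (simp add: scaleC_complex_def)
  show "\<exists>K. \<forall>x y. cmod (matrix_form a x y) \<le> norm x * norm y * K"
    using matrix_form_le by (intro exI[of _ 1]) simp
qed (simp_all add: matrix_form_add_left matrix_form_add_right)

text \<open>The product rule gives a complex linear derivative, and on the unit ball the quadratic
  form is Lipschitz with constant 2.\<close>

lemma matrix_form_in_Au: "(\<lambda>x. if x \<in> ball 0 1 then matrix_form a x x else 0) \<in> Au_set"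
proof -
  interpret bounded_bilinear "matrix_form a" by (rule bounded_bilinear_matrix_form)
  have "cholomorphic_on (\<lambda>x. matrix_form a x x) (ball 0 1)"
    unfolding cholomorphic_on_def
  proof
    fix x :: l1
    have "((\<lambda>x. matrix_form a x x) has_derivative (\<lambda>h. matrix_form a x h + matrix_form a h x)) (at x)"
      using FDERIV[OF has_derivative_ident has_derivative_ident] .
    moreover from this have "bounded_clinear (\<lambda>h. matrix_form a x h + matrix_form a h x)"
      by (auto simp: bounded_clinear_iff scaleC_complex_def matrix_form_scaleC_left
          matrix_form_scaleC_right algebra_simps dest: has_derivative_bounded_linear)
    ultimately show "\<exists>f'. bounded_clinear f' \<and> ((\<lambda>x. matrix_form a x x) has_derivative f') (at x)"
      by blast
  qed
  then have "cholomorphic_on (\<lambda>x. if x \<in> ball 0 1 then matrix_form a x x else 0) (ball 0 1)"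
    by (subst cholomorphic_on_cong[of "ball 0 1" _ "\<lambda>x. matrix_form a x x"]) auto
  moreover have "uniformly_continuous_on (ball 0 1) (\<lambda>x. if x \<in> ball 0 1 then matrix_form a x x else 0)"
    unfolding uniformly_continuous_on_def
  proof (intro allI impI exI conjI ballI)
    fix e :: real and x y :: l1
    assume e: "e > 0" and x: "x \<in> ball 0 1" and y: "y \<in> ball 0 1" and d: "dist y x < e / 2"
    have "matrix_form a y y - matrix_form a x x = matrix_form a (y - x) y + matrix_form a x (y - x)"
      by (simp add: diff_left diff_right)
    also have "cmod \<dots> \<le> norm (y - x) * norm y + norm x * norm (y - x)"
      by (intro norm_triangle_le add_mono matrix_form_le)
    also have "\<dots> \<le> norm (y - x) * 1 + 1 * norm (y - x)"
      using x y by (intro add_mono mult_mono) auto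
    also have "\<dots> < e" using d by (simp add: dist_norm)
    finally show "dist (if y \<in> ball 0 1 then matrix_form a y y else 0)
        (if x \<in> ball 0 1 then matrix_form a x x else 0) < e"
      using x y by (simp add: dist_norm)
  qed auto
  ultimately show ?thesis by (auto simp: Au_set_def)
qed

lemma matrix_form_restrict:
  assumes "\<And>i j. i \<notin> T \<or> j \<notin> T \<Longrightarrow> a i j = 0"
  shows "matrix_form a (l1_restrict T x) (l1_restrict T y) = matrix_form a x y"
proof -
  have *: "a i j * l1_nth (l1_restrict T y) j = a i j * l1_nth y j" for i j
    using assms[of i j] by (auto simp: l1_restrict.rep_eq)
  then have row: "cdual_apply (linf_dual (a i)) (l1_restrict T y) = cdual_apply (linf_dual (a i)) y" for i
    by (simp only: linf_dual_apply[OF matrix_row_bounded] *)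
  have **: "cdual_apply (linf_dual (a i)) y * l1_nth (l1_restrict T x) i
      = cdual_apply (linf_dual (a i)) y * l1_nth x i" for i
  proof (cases "i \<in> T")
    case False
    then have "cdual_apply (linf_dual (a i)) y = 0"
      using assms[of i] by (simp add: linf_dual_apply matrix_row_bounded)
    then show ?thesis by simp
  qed (simp add: l1_restrict.rep_eq)
  then show ?thesis
    by (simp only: matrix_form_def row linf_dual_apply[OF matrix_column_bounded] **)
qed

lemma matrix_form_restrict_le:
  assumes "\<And>i j. i \<notin> T \<or> j \<notin> T \<Longrightarrow> a i j = 0"
  shows "cmod (matrix_form a x y) \<le> norm (l1_restrict T x) * norm (l1_restrict T y)"
  using matrix_form_le[of "l1_restrict T x" "l1_restrict T y"] matrix_form_restrict[OF assms] by simp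

end

text \<open>The associated quadratic form is \<open>Q\<^sub>P - Q\<^sub>R\<close> with \<open>P = T \<inter> A\<close>, \<open>R = T - A\<close> and
  \<open>Q\<^sub>B x = 2 (\<Sum>i\<in>B. (x\<^sub>i)\<^sup>2) - (\<Sum>i\<in>B. x\<^sub>i)\<^sup>2\<close>, so that \<open>Q\<^sub>B ((e\<^sub>i - e\<^sub>j) / 2) = 1\<close> for \<open>i \<noteq> j\<close> in \<open>B\<close>.\<close>

definition sep_matrix :: "nat set \<Rightarrow> nat set \<Rightarrow> nat \<Rightarrow> nat \<Rightarrow> complex" where
  "sep_matrix T A i j = (if i \<in> T \<and> j \<in> T \<and> (i \<in> A \<longleftrightarrow> j \<in> A)
     then (if i \<in> A then 1 else - 1) * (if i = j then 1 else - 1) else 0)"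

lemma sep_matrix_le: "cmod (sep_matrix T A i j) \<le> 1"
  by (simp add: sep_matrix_def)

lemma sep_matrix_eq_0: "i \<notin> T \<or> j \<notin> T \<Longrightarrow> sep_matrix T A i j = 0"
  by (auto simp: sep_matrix_def)

lift_definition sep_poly :: "nat set \<Rightarrow> nat set \<Rightarrow> l1 Au" is
  "\<lambda>T A x. if x \<in> ball 0 1 then matrix_form (sep_matrix T A) x x else 0"
  by (rule matrix_form_in_Au) (rule sep_matrix_le)

text \<open>The matrix is supported in \<open>T \<times> T\<close> with entries of modulus at most
  1. The bound leaves the mass of \<open>x\<close> off \<open>T\<close> free for a second
  factor.\<close>

lemma sep_poly_le:
  "cmod (Au_apply (sep_poly T A) x) \<le> (norm (l1_restrict T x))\<^sup>2"
  using matrix_form_restrict_le[of "sep_matrix T A" T x x, OF sep_matrix_le sep_matrix_eq_0]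
  by (simp add: sep_poly.rep_eq power2_eq_square)

text \<open>The perturbation \<open>w\<close> alone contributes exactly plus or minus
  \<open>s\<^sup>2\<close>. The other three terms all involve \<open>y\<close>, whose norm on
  \<open>T\<close> is at most \<open>\<eta>\<close>.\<close>

lemma sep_poly_value:
  assumes "i \<in> T" "j \<in> T" "i \<noteq> j" "i \<in> A \<longleftrightarrow> j \<in> A"
    and s: "0 \<le> s" "s \<le> 1" and y: "norm (l1_restrict T y) \<le> \<eta>" "\<eta> \<le> 1"
    and p: "p = y + complex_of_real (s / 2) *\<^sub>C (l1_unit i + (- 1) *\<^sub>C l1_unit j)" "norm p < 1"
  shows "cmod (Au_apply (sep_poly T A) p - (if i \<in> A then 1 else - 1) * complex_of_real (s\<^sup>2)) \<le> 3 * \<eta>"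
proof -
  let ?a = "sep_matrix T A" and ?q = "matrix_form (sep_matrix T A)"
  note rules = matrix_form_add_left[OF sep_matrix_le] matrix_form_add_right[OF sep_matrix_le]
    matrix_form_scaleC_left[OF sep_matrix_le] matrix_form_scaleC_right[OF sep_matrix_le]
    matrix_form_unit[OF sep_matrix_le]
  define w where "w = complex_of_real (s / 2) *\<^sub>C (l1_unit i + (- 1) *\<^sub>C l1_unit j)"
  have ww: "?q w w = (if i \<in> A then 1 else - 1) * complex_of_real (s\<^sup>2)"
    unfolding w_def rules using assms(1-4)
    by (auto simp: sep_matrix_def power2_eq_square field_simps)
  have "norm (l1_unit i + (- 1) *\<^sub>C l1_unit j) \<le> 1 + 1"
    by (rule norm_triangle_le) (simp add: norm_scaleC)
  then have w: "norm w \<le> 1"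
    using s mult_mono[of "s / 2" "1 / 2" "norm (l1_unit i + (- 1) *\<^sub>C l1_unit j)" 2]
    by (simp add: w_def norm_scaleC)
  have Tw: "norm (l1_restrict T w) \<le> 1"
    using norm_l1_restrict_Compl[of T w] w norm_ge_zero[of "l1_restrict (- T) w"] by linarith
  have \<eta>: "0 \<le> \<eta>" using y(1) norm_ge_zero order_trans by blast
  have bound: "cmod (?q u v) \<le> norm (l1_restrict T u) * norm (l1_restrict T v)" for u v
    by (rule matrix_form_restrict_le) (auto simp: sep_matrix_le sep_matrix_eq_0)
  have "?q p p - ?q w w = ?q y y + ?q y w + ?q w y"
    unfolding p(1) w_def[symmetric] by (simp add: rules)
  also have "cmod \<dots> \<le> cmod (?q y y) + cmod (?q y w) + cmod (?q w y)"
    by (intro norm_triangle_le add_mono order_refl)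
  also have "\<dots> \<le> 1 * \<eta> + \<eta> * 1 + 1 * \<eta>"
    by (intro add_mono order_trans[OF bound] mult_mono) (use y Tw \<eta> in auto)
  finally show ?thesis using p(2) by (simp add: ww sep_poly.rep_eq)
qed

text \<open>The independent family of Fichtenholz, Kantorovich and Hausdorff: an index \<open>k\<close> codes a number \<open>n\<close> and
  finitely many subsets of \<open>{0..<n}\<close>, and it belongs to the set of \<open>X\<close> if \<open>X \<inter> {0..<n}\<close> is among them.\<close>

definition indep :: "nat set \<Rightarrow> nat set" where
  "indep X = {k. \<exists>n L. from_nat k = (n :: nat, L :: bool list list) \<and> map (\<lambda>i. i \<in> X) [0..<n] \<in> set L}"

text \<open>For large \<open>n\<close> the initial segments of length \<open>n\<close> tell the
  members of \<open>\<X>\<close> apart. An index coding \<open>n\<close> and the segments of the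
  members of \<open>\<X> \<inter> S\<close> then has the right pattern, and different
  \<open>n\<close> give different indices.\<close>

lemma infinite_indep:
  assumes "finite \<X>"
  shows "infinite {k. \<forall>X\<in>\<X>. k \<in> indep X \<longleftrightarrow> X \<in> S}"
proof -
  define code where "code = (\<lambda>n X. map (\<lambda>i. i \<in> X) [0..<n])"
  have "\<exists>N. \<forall>X\<in>\<X>. \<forall>Y\<in>\<X>. \<forall>n\<ge>N. code n X = code n Y \<longrightarrow> X = Y"
  proof -
    have "\<exists>N. \<forall>n\<ge>N. code n X = code n Y \<longrightarrow> X = Y" for X Y
    proof (cases "X = Y")
      case False
      then obtain i where i: "(i \<in> X) \<noteq> (i \<in> Y)" by blast
      have "code n X \<noteq> code n Y" if "n \<ge> Suc i" for n
        using i that by (auto simp: code_def)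
      then show ?thesis by blast
    qed blast
    then obtain N where N: "\<And>X Y n. n \<ge> N X Y \<Longrightarrow> code n X = code n Y \<Longrightarrow> X = Y" by metis
    define N' where "N' = Max (insert 0 ((\<lambda>(X, Y). N X Y) ` (\<X> \<times> \<X>)))"
    have "N X Y \<le> N'" if "X \<in> \<X>" "Y \<in> \<X>" for X Y
      unfolding N'_def using assms that by (intro Max_ge) auto
    then show ?thesis using N by (meson order_trans)
  qed
  then obtain N where N: "\<And>X Y n. X \<in> \<X> \<Longrightarrow> Y \<in> \<X> \<Longrightarrow> n \<ge> N \<Longrightarrow> code n X = code n Y \<Longrightarrow> X = Y"
    by blast
  have "\<exists>L. set L = code n ` (\<X> \<inter> S)" for n
    using assms by (intro finite_list) auto
  then obtain L where L: "\<And>n. set (L n) = code n ` (\<X> \<inter> S)" by metis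
  define g where "g n = to_nat (n, L n)" for n
  have "inj g" by (auto simp: g_def inj_def)
  then have "infinite (g ` {N..})"
    using finite_imageD[OF _ inj_on_subset[OF _ subset_UNIV]] infinite_Ici by blast
  moreover have "g n \<in> {k. \<forall>X\<in>\<X>. k \<in> indep X \<longleftrightarrow> X \<in> S}" if "n \<ge> N" for n
  proof -
    have "g n \<in> indep X \<longleftrightarrow> code n X \<in> code n ` (\<X> \<inter> S)" for X
      by (simp add: g_def indep_def code_def L)
    then show ?thesis using N that by blast
  qed
  then have "g ` {N..} \<subseteq> {k. \<forall>X\<in>\<X>. k \<in> indep X \<longleftrightarrow> X \<in> S}" by auto
  ultimately show ?thesis using finite_subset by blast
qed

subsection \<open>Characters in the fiber\<close>

text \<open>The point is \<open>p = y + (s / 2) (e\<^sub>i - e\<^sub>j)\<close>, where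
  \<open>y\<close> imitates \<open>z\<close>, and \<open>i = d k\<close>, \<open>j = d l\<close>
  share a label while \<open>k\<close> and \<open>l\<close> have the pattern prescribed by
  \<open>S\<close>.\<close>

lemma exists_test_point:
  fixes z :: "l1 cdual cdual" and S :: "nat set set"
  assumes z: "norm z < 1" and d: "strict_mono d" "\<And>M. mass_le z (d ` {M..}) (1 / 2 ^ M)"
    and fin: "finite F" "finite \<X>" and \<epsilon>: "\<epsilon> > 0"
  obtains p where "norm p < 1" "\<And>f. f \<in> F \<Longrightarrow> cmod (cdual_apply f p - cdual_apply z f) \<le> \<epsilon>"
    "\<And>X M. X \<in> \<X> \<Longrightarrow> M \<le> N \<Longrightarrow>
      cmod (Au_apply (sep_poly (d ` {M..}) (d ` indep X)) p
        - (if X \<in> S then 1 else - 1) * complex_of_real ((1 - norm z)\<^sup>2)) \<le> 3 / 2 ^ M + \<epsilon>"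
proof -
  define t where "t = 1 - norm z"
  have t: "0 < t" "t \<le> 1" using z by (auto simp: t_def)
  define T where "T M = d ` {M..}" for M
  \<comment> \<open>Taking \<open>s\<close> slightly below \<open>t\<close> keeps
    \<open>norm p\<close> strictly below 1; the loss \<open>t\<^sup>2 - s\<^sup>2\<close> is at most
    \<open>2 * \<delta> \<le> \<epsilon>\<close>.\<close>
  define \<delta> where "\<delta> = min (t / 2) (\<epsilon> / 2)"
  define s where "s = t - \<delta>"
  have \<delta>: "0 < \<delta>" "\<delta> \<le> \<epsilon> / 2" "\<delta> < t" using t \<epsilon> by (auto simp: \<delta>_def)
  have s: "0 \<le> s" "s \<le> 1" "s < t" using \<delta> t by (auto simp: s_def)
  \<comment> \<open>A tolerance below 1 forces the indicators \<open>ind M\<close> to agree at equal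
    labels, so each \<open>T M\<close> with \<open>M \<le> N\<close> is a union of classes.\<close>
  define \<epsilon>' where "\<epsilon>' = min (\<epsilon> / 2) (1 / 2)"
  have \<epsilon>': "0 < \<epsilon>'" "\<epsilon>' \<le> \<epsilon> / 2" "\<epsilon>' < 1" using \<epsilon> by (auto simp: \<epsilon>'_def)
  define ev where "ev f = (\<lambda>n. cdual_apply f (l1_unit n))" for f
  define ind where "ind M = (\<lambda>n. if n \<in> T M then 1 else 0 :: complex)" for M
  have bdd: "bounded (range b)" if "b \<in> ev ` F \<union> ind ` {..N}" for b
  proof -
    have "bounded (range (ind M))" for M
      by (auto simp: ind_def bounded_iff intro!: exI[of _ 1])
    then show ?thesis using that bounded_cdual_unit by (auto simp: ev_def)
  qed
  have finB: "finite (ev ` F \<union> ind ` {..N})" using fin by simp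
  obtain \<pi> :: "nat \<Rightarrow> complex list" where \<pi>: "finite (range \<pi>)"
    "\<And>b m n. b \<in> ev ` F \<union> ind ` {..N} \<Longrightarrow> \<pi> m = \<pi> n \<Longrightarrow> cmod (b m - b n) \<le> \<epsilon>'"
    using exists_labelling[OF finB bdd \<epsilon>'(1)] by auto
  obtain y where y:
    "\<And>b \<epsilon>. bounded (range b) \<Longrightarrow> (\<And>m n. \<pi> m = \<pi> n \<Longrightarrow> cmod (b m - b n) \<le> \<epsilon>) \<Longrightarrow>
      cmod (cdual_apply (linf_dual b) y - cdual_apply z (linf_dual b)) \<le> \<epsilon> * norm z"
    "\<And>D \<eta>. mass_le z D \<eta> \<Longrightarrow> (\<And>m n. \<pi> m = \<pi> n \<Longrightarrow> m \<in> D \<Longrightarrow> n \<in> D) \<Longrightarrow> norm (l1_restrict D y) \<le> \<eta>"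
    using exists_l1_approx[OF \<pi>(1), of z] by blast
  have norm_y: "norm y \<le> norm z"
    using y(2)[OF mass_le_UNIV] by simp
  have yT: "norm (l1_restrict (T M) y) \<le> 1 / 2 ^ M" if "M \<le> N" for M
  proof (rule y(2))
    show "mass_le z (T M) (1 / 2 ^ M)" using d by (simp add: T_def)
    show "n \<in> T M" if "\<pi> m = \<pi> n" "m \<in> T M" for m n
      using \<pi>(2)[of "ind M" m n] that \<open>M \<le> N\<close> \<epsilon>'(3) by (auto simp: ind_def split: if_splits)
  qed
  have yF: "cmod (cdual_apply f y - cdual_apply z f) \<le> \<epsilon> / 2" if "f \<in> F" for f
  proof -
    have "cmod (cdual_apply f y - cdual_apply z f) \<le> \<epsilon>' * norm z"
      using y(1)[of "ev f" \<epsilon>'] \<pi>(2)[of "ev f"] bdd[of "ev f"] that by (simp add: ev_def linf_dual_cdual)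
    also have "\<dots> \<le> \<epsilon>' * 1" using z \<epsilon>' by (intro mult_left_mono) auto
    finally show ?thesis using \<epsilon>' by simp
  qed
  have inj: "d k = d l \<longleftrightarrow> k = l" for k l using strict_mono_eq[OF d(1)] .
  \<comment> \<open>Discarding the indices below \<open>N\<close> puts \<open>d k\<close> into
    \<open>T M\<close> for all \<open>M \<le> N\<close>. As \<open>H\<close> is infinite and the
    labels are finitely many, two of its elements share a label.\<close>
  define H where "H = {k. \<forall>X\<in>\<X>. k \<in> indep X \<longleftrightarrow> X \<in> S} - {..<N}"
  have "infinite H" unfolding H_def using infinite_indep[OF fin(2)] by (rule Diff_infinite_finite[rotated]) simp
  then have "\<not> inj_on (\<lambda>k. \<pi> (d k)) H"
    using finite_imageD finite_subset[OF _ \<pi>(1), of "(\<lambda>k. \<pi> (d k)) ` H"] by blast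
  then obtain k l where kl: "k \<in> H" "l \<in> H" "\<pi> (d k) = \<pi> (d l)" "k \<noteq> l"
    by (auto simp: inj_on_def)
  define w where "w = l1_unit (d k) + (- 1) *\<^sub>C l1_unit (d l)"
  define p where "p = y + complex_of_real (s / 2) *\<^sub>C w"
  have "norm w \<le> 1 + 1"
    unfolding w_def by (rule norm_triangle_le) (simp add: norm_scaleC)
  then have "norm (complex_of_real (s / 2) *\<^sub>C w) \<le> s"
    using s mult_left_mono[of "norm w" 2 "s / 2"] by (simp add: norm_scaleC)
  then have p: "norm p < 1"
    unfolding p_def using norm_y s(3) norm_triangle_ineq[of y "complex_of_real (s / 2) *\<^sub>C w"]
    by (simp add: t_def)
  show ?thesis
  proof (rule that[OF p])
    fix f assume f: "f \<in> F"
    have "cdual_apply f p - cdual_apply z f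
        = (cdual_apply f y - cdual_apply z f) + complex_of_real (s / 2) * (ev f (d k) - ev f (d l))"
      by (simp add: p_def w_def cdual_apply_add cdual_apply_scaleC ev_def)
    also have "cmod \<dots> \<le> \<epsilon> / 2 + s / 2 * \<epsilon>'"
      using yF[OF f] \<pi>(2)[of "ev f" "d k" "d l"] kl f s
      by (intro norm_triangle_le add_mono) (auto simp: norm_mult intro!: mult_left_mono)
    also have "\<dots> \<le> \<epsilon> / 2 + 1 * (\<epsilon> / 2)"
      using s \<epsilon>' by (intro add_mono mult_mono) auto
    finally show "cmod (cdual_apply f p - cdual_apply z f) \<le> \<epsilon>" by simp
  next
    fix X M assume XM: "X \<in> \<X>" "M \<le> N"
    have "d k \<in> T M" "d l \<in> T M" using kl XM by (auto simp: T_def H_def)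
    moreover have A: "d k \<in> d ` indep X \<longleftrightarrow> X \<in> S" "d l \<in> d ` indep X \<longleftrightarrow> X \<in> S"
      using kl XM by (auto simp: H_def inj image_iff)
    ultimately have 1:
      "cmod (Au_apply (sep_poly (T M) (d ` indep X)) p - (if d k \<in> d ` indep X then 1 else - 1) * complex_of_real (s\<^sup>2))
        \<le> 3 * (1 / 2 ^ M)"
      using kl s p yT[OF XM(2)]
      by (intro sep_poly_value[of _ _ "d l" _ _ y]) (auto simp: inj p_def w_def)
    have 2: "cmod ((if X \<in> S then 1 else - 1) * complex_of_real (s\<^sup>2)
        - (if X \<in> S then 1 else - 1) * complex_of_real (t\<^sup>2)) \<le> \<epsilon>"
    proof -
      have "cmod ((if X \<in> S then 1 else - 1) * complex_of_real (s\<^sup>2) - (if X \<in> S then 1 else - 1) * complex_of_real (t\<^sup>2))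
          = cmod ((if X \<in> S then 1 else - 1) * complex_of_real (s\<^sup>2 - t\<^sup>2))"
        by (simp add: algebra_simps)
      also have "\<dots> = \<bar>s\<^sup>2 - t\<^sup>2\<bar>"
        by (simp only: norm_mult norm_of_real) simp
      also have "s\<^sup>2 - t\<^sup>2 = - (\<delta> * (s + t))"
        by (simp add: s_def power2_eq_square algebra_simps)
      also have "\<bar>- (\<delta> * (s + t))\<bar> \<le> \<delta> * 2"
        using \<delta> s t by (simp add: abs_mult)
      finally show ?thesis using \<delta> by simp
    qed
    show "cmod (Au_apply (sep_poly (d ` {M..}) (d ` indep X)) p
        - (if X \<in> S then 1 else - 1) * complex_of_real ((1 - norm z)\<^sup>2)) \<le> 3 / 2 ^ M + \<epsilon>"
      using norm_diff_triangle_le[OF 1[unfolded A] 2] by (simp add: t_def T_def)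
  qed
qed

section \<open>Characters as limits of point evaluations\<close>

lemma Au_apply_le: "cmod (Au_apply f x) \<le> norm f"
proof -
  have "cmod (Au_apply f x) \<le> norm f" if "x \<in> ball 0 1" for x
    unfolding norm_Au.rep_eq by (rule cSUP_upper[OF that bdd_above_Au]) (rule Au_apply)
  then show ?thesis
    using Au_apply[of f] by (cases "x \<in> ball 0 1") (auto simp: Au_set_def)
qed

lemma norm_Au_le: "(\<And>x. x \<in> ball 0 1 \<Longrightarrow> cmod (Au_apply f x) \<le> K) \<Longrightarrow> norm f \<le> K"
  unfolding norm_Au.rep_eq by (rule cSUP_least) auto

text \<open>A product of closed discs is compact, and the unital multiplicative functionals form a
  closed set containing the evaluations. So the closed conditions need to be met only finitely many
  at a time.\<close>

lemma exists_character:
  fixes W :: "'i \<Rightarrow> ('a::complex_normed_vector Au \<Rightarrow> complex) set"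
  assumes closed: "\<And>i. i \<in> I \<Longrightarrow> closed (W i)"
    and fip: "\<And>J. finite J \<Longrightarrow> J \<subseteq> I \<Longrightarrow> \<exists>p. norm p < 1 \<and> (\<forall>i\<in>J. (\<lambda>f. Au_apply f p) \<in> W i)"
  obtains \<phi> where "\<phi> \<in> Au_spectrum" "\<And>i. i \<in> I \<Longrightarrow> \<phi> \<in> W i"
proof -
  define B :: "('a Au \<Rightarrow> complex) set" where "B = PiE UNIV (\<lambda>f. cball 0 (norm f))"
  \<comment> \<open>Being nonzero is not preserved by pointwise limits; the normalisation
    \<open>\<phi> 1 = 1\<close> is.\<close>
  define C :: "('a Au \<Rightarrow> complex) set" where
    "C = {\<phi>. (\<forall>f g. \<phi> (f + g) = \<phi> f + \<phi> g) \<and> (\<forall>c f. \<phi> (c *\<^sub>C f) = c * \<phi> f) \<and>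
      (\<forall>f g. \<phi> (f * g) = \<phi> f * \<phi> g) \<and> \<phi> 1 = 1}"
  have "compactin (product_topology (\<lambda>f. euclidean) UNIV) B"
    unfolding B_def compactin_PiE by simp
  then have "compact B"
    by (simp add: euclidean_product_topology)
  moreover have "closed C"
    unfolding C_def
    by (intro closed_Collect_conj closed_Collect_all closed_Collect_eq continuous_intros)
      (auto intro!: continuous_intros)
  ultimately have "compact (B \<inter> C)" by (rule compact_Int_closed)
  then have "(B \<inter> C) \<inter> (\<Inter>i\<in>I. W i) \<noteq> {}"
  proof (rule compact_imp_fip_image[OF _ closed])
    fix J assume "finite J" "J \<subseteq> I"
    then obtain p where p: "norm p < 1" "\<forall>i\<in>J. (\<lambda>f. Au_apply f p) \<in> W i" using fip by blast
    have "(\<lambda>f. Au_apply f p) \<in> B \<inter> C"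
      using p(1) by (auto simp: B_def C_def Au_apply_le plus_Au.rep_eq scaleC_Au.rep_eq times_Au.rep_eq one_Au.rep_eq)
    then show "(B \<inter> C) \<inter> (\<Inter>i\<in>J. W i) \<noteq> {}" using p by blast
  qed
  then obtain \<phi> where \<phi>: "\<phi> \<in> C" "\<And>i. i \<in> I \<Longrightarrow> \<phi> \<in> W i" by blast
  then have "\<phi> \<in> Au_spectrum"
    by (auto simp: C_def Au_spectrum_def clinear_def scaleC_complex_def intro!: exI[of _ 1])
  then show ?thesis using that \<phi>(2) by blast
qed

text \<open>All conditions are imposed up to every positive tolerance, which makes them closed and
  finitely satisfiable at test points. Afterwards the tolerance tends to 0.\<close>

lemma exists_fiber_character:
  fixes z :: "l1 cdual cdual" and S :: "nat set set"
  assumes z: "norm z < 1" and d: "strict_mono d" "\<And>M. mass_le z (d ` {M..}) (1 / 2 ^ M)"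
  shows "\<exists>\<phi>\<in>Au_fiber z. \<forall>X M. cmod (\<phi> (sep_poly (d ` {M..}) (d ` indep X))
        - (if X \<in> S then 1 else - 1) * complex_of_real ((1 - norm z)\<^sup>2)) \<le> 3 / 2 ^ M"
proof -
  define q where "q X M = sep_poly (d ` {M..}) (d ` indep X)" for X M
  define v where "v X = (if X \<in> S then 1 else - 1) * complex_of_real ((1 - norm z)\<^sup>2)" for X
  define W where "W = (\<lambda>(f, X, M::nat, \<epsilon>). {\<phi> :: l1 Au \<Rightarrow> complex.
    cmod (\<phi> (cdual_to_Au f) - cdual_apply z f) \<le> \<epsilon> \<and> cmod (\<phi> (q X M) - v X) \<le> 3 / 2 ^ M + \<epsilon>})"
  define I :: "(l1 cdual \<times> nat set \<times> nat \<times> real) set" where "I = {(f, X, M, \<epsilon>). \<epsilon> > 0}"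
  obtain \<phi> where \<phi>: "\<phi> \<in> Au_spectrum" "\<And>i. i \<in> I \<Longrightarrow> \<phi> \<in> W i"
  proof (rule exists_character[of I W])
    show "closed (W i)" for i
      unfolding W_def
      by (cases i) (auto intro!: closed_Collect_conj closed_Collect_le continuous_intros)
    fix J assume J: "finite J" "J \<subseteq> I"
    \<comment> \<open>Common bounds for all conditions in \<open>J\<close>; the inserted 0 and 1
      cover empty \<open>J\<close>.\<close>
    define N where "N = Max (insert 0 ((\<lambda>(f, X, M, \<epsilon>). M) ` J))"
    define e where "e = Min (insert 1 ((\<lambda>(f, X, M, \<epsilon>). \<epsilon>) ` J))"
    have "e > 0" unfolding e_def using J by (subst Min_gr_iff) (auto simp: I_def)
    have Ne: "M \<le> N" "e \<le> \<epsilon>" if "(f, X, M, \<epsilon>) \<in> J" for f X M \<epsilon>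
      unfolding N_def e_def using J that by (force intro: Max_ge Min_le)+
    obtain p where p: "norm p < 1"
      "\<And>f. f \<in> fst ` J \<Longrightarrow> cmod (cdual_apply f p - cdual_apply z f) \<le> e"
      "\<And>X M. X \<in> (fst \<circ> snd) ` J \<Longrightarrow> M \<le> N \<Longrightarrow> cmod (Au_apply (q X M) p - v X) \<le> 3 / 2 ^ M + e"
      using exists_test_point[OF z d, of "fst ` J" "(fst \<circ> snd) ` J" e N S] J(1) \<open>e > 0\<close>
      unfolding q_def v_def by (metis (no_types, lifting) finite_imageI)
    have "(\<lambda>f. Au_apply f p) \<in> W i" if iJ: "i \<in> J" for i
    proof (cases i)
      case (fields f X M \<epsilon>)
      have "f \<in> fst ` J" "X \<in> (fst \<circ> snd) ` J" using iJ fields by force+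
      then show ?thesis
        using p(1) p(2)[of f] p(3)[of X M] Ne[of f X M \<epsilon>] iJ fields
        by (auto simp: W_def cdual_to_Au.rep_eq)
    qed
    then show "\<exists>p. norm p < 1 \<and> (\<forall>i\<in>J. (\<lambda>f. Au_apply f p) \<in> W i)" using p(1) by blast
  qed blast
  have W: "cmod (\<phi> (cdual_to_Au f) - cdual_apply z f) \<le> \<epsilon>" "cmod (\<phi> (q X M) - v X) \<le> 3 / 2 ^ M + \<epsilon>"
    if "\<epsilon> > 0" for f X M \<epsilon>
    using \<phi>(2)[of "(f, X, M, \<epsilon>)"] that by (auto simp: I_def W_def)
  have "cmod (\<phi> (cdual_to_Au f) - cdual_apply z f) \<le> 0" for f
    by (rule field_le_epsilon) (use W(1) in simp)
  moreover have "cmod (\<phi> (q X M) - v X) \<le> 3 / 2 ^ M" for X M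
    by (rule field_le_epsilon) (use W(2) in simp)
  ultimately show ?thesis
    using \<phi>(1) unfolding q_def v_def Au_fiber_def by (intro bexI[of _ \<phi>]) simp_all
qed

subsection \<open>Distance between the characters\<close>

text \<open>By \<open>x \<le> exp (x - 1)\<close> for each base, the exponents add up to
  \<open>(m + k) * (\<alpha> + \<beta> - 1) \<le> 0\<close>.\<close>

lemma peak_monomial_le_1:
  fixes \<alpha> \<beta> :: real
  assumes "m > 0" "k > 0" "0 \<le> \<alpha>" "0 \<le> \<beta>" "\<alpha> + \<beta> \<le> 1"
  shows "(real (m + k) / real m * \<alpha>) ^ m * (real (m + k) / real k * \<beta>) ^ k \<le> 1"
proof -
  have le: "x ^ j \<le> exp (real j * (x - 1))" if "0 \<le> x" for x :: real and j
    using power_mono[OF exp_ge_add_one_self[of "x - 1"], of j] that by (simp add: exp_of_nat_mult)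
  have "(real (m + k) / real m * \<alpha>) ^ m * (real (m + k) / real k * \<beta>) ^ k
      \<le> exp (real m * (real (m + k) / real m * \<alpha> - 1)) * exp (real k * (real (m + k) / real k * \<beta> - 1))"
    using assms by (intro mult_mono le) auto
  also have "\<dots> = exp (real (m + k) * (\<alpha> + \<beta>) - real (m + k))"
    using assms by (simp add: exp_add[symmetric] field_simps)
  also have "\<dots> \<le> 1"
    using assms mult_left_mono[of "\<alpha> + \<beta>" 1 "real (m + k)"] by simp
  finally show ?thesis .
qed

text \<open>With \<open>k = 2 * n\<close>, the normalised monomial peaks at
  \<open>(m / (m + k), k / (m + k))\<close> with value 1. For large exponents with ratio rounded
  from \<open>1 - t : t\<close>, the value at \<open>(1 - t, t)\<close> is almost that of the
  peak.\<close>

lemma exists_peak_monomial: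
  fixes t :: real
  assumes t: "0 < t" "t \<le> 1" and \<epsilon>: "\<epsilon> > 0"
  obtains C :: real and m n :: nat where "C \<ge> 0" "odd n"
    "\<And>\<alpha> \<beta>. 0 \<le> \<alpha> \<Longrightarrow> 0 \<le> \<beta> \<Longrightarrow> \<alpha> + \<beta> \<le> 1 \<Longrightarrow> C * \<alpha> ^ m * \<beta> ^ (2 * n) \<le> 1"
    "1 - \<epsilon> \<le> C * (1 - t) ^ m * t ^ (2 * n)"
proof (cases "t = 1")
  case True
  \<comment> \<open>Here \<open>1 - t = 0\<close>, so the first exponent has to be 0:
    \<open>C = 1\<close>, \<open>n = 1\<close>, \<open>m = 0\<close>.\<close>
  show ?thesis
    by (rule that[of 1 1 0]) (use True \<epsilon> in \<open>auto simp: power_le_one\<close>)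
next
  case False
  then have t1: "t < 1" using t by simp
  \<comment> \<open>The first bound makes the final error at most \<open>\<epsilon>\<close>, the
    second makes \<open>m\<close> positive.\<close>
  obtain j :: nat where j: "max (1 / (\<epsilon> * (t * (1 - t)))) (t / (1 - t)) < real j"
    using reals_Archimedean2 by blast
  define n where "n = 2 * j + 1"
  define k where "k = 2 * n"
  define m where "m = nat \<lfloor>real k * (1 - t) / t\<rfloor>"
  define N where "N = real (m + k)"
  have "k > 0" by (simp add: k_def n_def)
  have jn: "real j \<le> real n" "real n \<le> N" by (auto simp: n_def N_def k_def)
  have "real k * (1 - t) / t \<ge> 1"
  proof -
    have "t / (1 - t) \<le> real k" using j jn by (simp add: k_def)
    then show ?thesis using t t1 by (simp add: field_simps)
  qed
  then have m: "m > 0" "real m \<le> real k * (1 - t) / t" "real k * (1 - t) / t \<le> real m + 1"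
    unfolding m_def by linarith+
  \<comment> \<open>The rounding error: \<open>k\<close> exceeds its ideal share
    \<open>N * t\<close> by \<open>D\<close>, and \<open>m\<close> falls short of
    \<open>N * (1 - t)\<close> by the same amount.\<close>
  define D where "D = real k - N * t"
  have "D = real k * (1 - t) - real m * t" by (simp add: D_def N_def algebra_simps)
  moreover have "real m * t \<le> real k * (1 - t)" "real k * (1 - t) \<le> (real m + 1) * t"
    using m(2,3) t by (simp_all add: field_simps)
  ultimately have D: "0 \<le> D" "D \<le> 1" using t by (auto simp: algebra_simps)
  have N: "N > 0" using m by (simp add: N_def)
  define C where "C = (N / real m) ^ m * (N / real k) ^ k"
  have mono: "C * \<alpha> ^ m * \<beta> ^ (2 * n) = (N / real m * \<alpha>) ^ m * (N / real k * \<beta>) ^ k" for \<alpha> \<beta>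
    by (simp add: C_def k_def[symmetric] power_mult_distrib power_divide)
  \<comment> \<open>\<open>1 / x \<le> exp (1 / x - 1)\<close> gives
    \<open>exp (1 - 1 / x) \<le> x\<close>, used with \<open>x = N * s / i\<close>.\<close>
  have ge: "exp (real i - real i * real i / (N * s)) \<le> (N / real i * s) ^ i" if "i > 0" "s > 0" for i s
  proof -
    have "exp (1 - real i / (N * s)) = inverse (exp (real i / (N * s) - 1))"
      by (simp add: exp_minus[symmetric])
    also have "\<dots> \<le> inverse (real i / (N * s))"
      using that N by (intro le_imp_inverse_le) (use exp_ge_add_one_self[of "real i / (N * s) - 1"] in auto)
    finally have "exp (1 - real i / (N * s)) ^ i \<le> (N / real i * s) ^ i"
      by (intro power_mono) auto
    then show ?thesis by (simp add: exp_of_nat_mult[symmetric] algebra_simps)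
  qed
  have "1 - \<epsilon> \<le> exp (- \<epsilon>)"
    using exp_ge_add_one_self[of "- \<epsilon>"] by simp
  also have "\<dots> \<le> exp (- (D\<^sup>2 / (N * (t * (1 - t)))))"
  proof -
    have "1 / (\<epsilon> * (t * (1 - t))) \<le> N" using j jn by simp
    then have "1 \<le> N * (\<epsilon> * (t * (1 - t)))"
      using t t1 \<epsilon> by (simp add: pos_divide_le_eq)
    moreover have "D\<^sup>2 \<le> 1" using D by (simp add: power_le_one)
    ultimately have "D\<^sup>2 / (N * (t * (1 - t))) \<le> \<epsilon>"
      using t t1 N by (simp add: pos_divide_le_eq algebra_simps)
    then show ?thesis by simp
  qed
  \<comment> \<open>Expressing \<open>m\<close> and \<open>k\<close> through \<open>D\<close>
    cancels the terms of first order in \<open>D\<close>.\<close>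
  also have "- (D\<^sup>2 / (N * (t * (1 - t)))) = (real m - real m * real m / (N * (1 - t))) + (real k - real k * real k / (N * t))"
  proof -
    have mk: "real m = N * (1 - t) - D" "real k = N * t + D" by (simp_all add: D_def N_def algebra_simps)
    show ?thesis unfolding mk using N t t1 by (simp add: field_simps power2_eq_square)
  qed
  also have "exp \<dots> \<le> (N / real m * (1 - t)) ^ m * (N / real k * t) ^ k"
    unfolding exp_add using m \<open>k > 0\<close> t t1 N by (intro mult_mono ge) auto
  finally have "1 - \<epsilon> \<le> C * (1 - t) ^ m * t ^ (2 * n)" by (simp add: mono)
  then show ?thesis
  proof (rule that[rotated 3])
    show "C \<ge> 0" using N by (simp add: C_def)
    show "odd n" by (simp add: n_def)
    show "C * \<alpha> ^ m * \<beta> ^ (2 * n) \<le> 1" if "0 \<le> \<alpha>" "0 \<le> \<beta>" "\<alpha> + \<beta> \<le> 1" for \<alpha> \<beta>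
      unfolding mono N_def by (rule peak_monomial_le_1[OF m(1) \<open>k > 0\<close> that])
  qed
qed

section \<open>Test functions that tell the characters apart\<close>

lemma Au_spectrum_mult: "\<phi> \<in> Au_spectrum \<Longrightarrow> \<phi> (f * g) = \<phi> f * \<phi> g"
  by (simp add: Au_spectrum_def)

lemma Au_spectrum_one:
  assumes "\<phi> \<in> Au_spectrum"
  shows "\<phi> 1 = 1"
proof -
  obtain f where "\<phi> f \<noteq> 0" using assms by (auto simp: Au_spectrum_def)
  moreover have "\<phi> 1 * \<phi> f = \<phi> f" using Au_spectrum_mult[OF assms, of 1 f] by simp
  ultimately show ?thesis by simp
qed

lemma Au_spectrum_power: "\<phi> \<in> Au_spectrum \<Longrightarrow> \<phi> (f ^ k) = \<phi> f ^ k"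
  by (induction k) (simp_all add: Au_spectrum_one Au_spectrum_mult)

lemma Au_spectrum_scaleC: "\<phi> \<in> Au_spectrum \<Longrightarrow> \<phi> (c *\<^sub>C f) = c * \<phi> f"
  by (simp add: Au_spectrum_def clinear_def scaleC_complex_def)

lemma Au_apply_power: "x \<in> ball 0 1 \<Longrightarrow> Au_apply (f ^ k) x = Au_apply f x ^ k"
  by (induction k) (auto simp: one_Au.rep_eq times_Au.rep_eq)

lemma exists_norming_functional:
  fixes z :: "'a::complex_normed_vector cdual cdual"
  assumes "\<epsilon> > 0"
  obtains f where "norm f \<le> 1" "norm z - \<epsilon> \<le> cmod (cdual_apply z f)"
proof (cases "\<epsilon> < norm z")
  case True
  have "\<exists>f. \<not> cmod (cdual_apply z f) \<le> (norm z - \<epsilon>) * norm f"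
  proof (rule ccontr)
    assume "\<not> ?thesis"
    then have "norm z \<le> norm z - \<epsilon>" using True by (intro norm_cdual_le) auto
    then show False using assms by simp
  qed
  then obtain f where f: "(norm z - \<epsilon>) * norm f < cmod (cdual_apply z f)" by (auto simp: not_le)
  have "f \<noteq> 0" using f cdual_apply_le[of z f] by auto
  then have nf: "norm f > 0" by simp
  show ?thesis
  proof (rule that[of "complex_of_real (1 / norm f) *\<^sub>C f"])
    show "norm (complex_of_real (1 / norm f) *\<^sub>C f) \<le> 1"
      using nf by (simp add: norm_scaleC norm_divide)
    show "norm z - \<epsilon> \<le> cmod (cdual_apply z (complex_of_real (1 / norm f) *\<^sub>C f))"
      using f nf by (simp add: cdual_apply_scaleC norm_divide field_simps)
  qed
next
  case False
  then show ?thesis by (intro that[of 0]) (auto intro: order_trans[OF _ norm_ge_zero])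
qed

text \<open>A functional that norms \<open>z\<close> up to \<open>\<eta>\<close> is set to 0 on
  \<open>T\<close>. The part removed has \<open>z\<close>-value at most \<open>\<eta>\<close>, which
  accounts for the second \<open>\<eta>\<close>.\<close>

lemma exists_norming_functional_off:
  assumes "mass_le z T \<eta>" "\<eta> > 0"
  obtains u :: "l1 cdual" where "\<And>x. cmod (cdual_apply u x) \<le> norm (l1_restrict (- T) x)"
    "norm z - 2 * \<eta> \<le> cmod (cdual_apply z u)" "cmod (cdual_apply z u) \<le> norm z"
proof -
  obtain f where f: "norm f \<le> 1" "norm z - \<eta> \<le> cmod (cdual_apply z f)"
    using exists_norming_functional[OF assms(2)] by blast
  define b where "b = (\<lambda>n. if n \<in> T then 0 else cdual_apply f (l1_unit n))"
  define c where "c = (\<lambda>n. if n \<in> T then cdual_apply f (l1_unit n) else 0)"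
  have fn: "cmod (cdual_apply f (l1_unit n)) \<le> 1" for n
    using cmod_cdual_unit_le f(1) order_trans by blast
  have bc: "cmod (b n) \<le> 1" "cmod (c n) \<le> 1" for n using fn by (auto simp: b_def c_def)
  have bdd: "bounded (range b)" "bounded (range c)" using bc by (auto simp: bounded_iff)
  have nb: "norm (linf_dual b) \<le> 1" by (rule norm_linf_dual_le) (rule bc)
  have "(\<lambda>n. b n + c n) = (\<lambda>n. cdual_apply f (l1_unit n))" by (auto simp: b_def c_def)
  then have "f = linf_dual b + linf_dual c"
    using linf_dual_add[OF bdd] linf_dual_cdual[of f] by simp
  then have "cmod (cdual_apply z f) \<le> cmod (cdual_apply z (linf_dual b)) + cmod (cdual_apply z (linf_dual c))"
    by (simp add: cdual_apply_add norm_triangle_ineq)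
  moreover have "cmod (cdual_apply z (linf_dual c)) \<le> \<eta>"
    by (rule mass_leD[OF assms(1)]) (use bc in \<open>auto simp: c_def\<close>)
  moreover have "cmod (cdual_apply (linf_dual b) x) \<le> norm (l1_restrict (- T) x)" for x
  proof -
    have "b n * l1_nth (l1_restrict (- T) x) n = b n * l1_nth x n" for n
      by (simp add: b_def l1_restrict.rep_eq)
    then have "cdual_apply (linf_dual b) x = cdual_apply (linf_dual b) (l1_restrict (- T) x)"
      by (simp only: linf_dual_apply[OF bdd(1)])
    then show ?thesis
      using cdual_apply_le[of "linf_dual b" "l1_restrict (- T) x"] nb
        mult_right_mono[OF nb norm_ge_zero[of "l1_restrict (- T) x"]] by simp
  qed
  moreover have "cmod (cdual_apply z (linf_dual b)) \<le> norm z"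
    using cdual_apply_le[of z "linf_dual b"] mult_left_mono[OF nb norm_ge_zero[of z]] by simp
  ultimately show ?thesis using f by (intro that[of "linf_dual b"]) auto
qed

text \<open>The test function is \<open>C u\<^sup>m q\<^sup>n\<close> with \<open>u\<close>
  controlled by the mass off \<open>T M\<close> and \<open>q\<close> by the mass on
  \<open>T M\<close>, so the hypothesis on \<open>C\<close> bounds it by 1. Both characters agree on
  \<open>u\<close>, and as \<open>M\<close> grows their values at \<open>q\<close> tend to opposite
  limits.\<close>

lemma Au_functional_dist_ge:
  fixes \<phi> \<psi> :: "l1 Au \<Rightarrow> complex" and t :: real
  assumes \<phi>: "\<phi> \<in> Au_fiber z" and \<psi>: "\<psi> \<in> Au_fiber z"
    and T: "\<And>M. mass_le z (T M) (1 / 2 ^ M)"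
    and \<phi>q: "\<And>M. cmod (\<phi> (sep_poly (T M) A) - complex_of_real (t\<^sup>2)) \<le> 3 / 2 ^ M"
    and \<psi>q: "\<And>M. cmod (\<psi> (sep_poly (T M) A) + complex_of_real (t\<^sup>2)) \<le> 3 / 2 ^ M"
    and C: "C \<ge> 0" "odd n"
      "\<And>\<alpha> \<beta>. 0 \<le> \<alpha> \<Longrightarrow> 0 \<le> \<beta> \<Longrightarrow> \<alpha> + \<beta> \<le> 1 \<Longrightarrow> C * \<alpha> ^ m * \<beta> ^ (2 * n) \<le> 1"
  shows "ereal (2 * (C * norm z ^ m * t ^ (2 * n))) \<le> Au_functional_dist \<phi> \<psi>"
proof -
  have spec: "\<phi> \<in> Au_spectrum" "\<psi> \<in> Au_spectrum" using \<phi> \<psi> by (auto simp: Au_fiber_def)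
  have "\<exists>u :: l1 cdual. (\<forall>x. cmod (cdual_apply u x) \<le> norm (l1_restrict (- T M) x)) \<and>
    norm z - 2 * (1 / 2 ^ M) \<le> cmod (cdual_apply z u) \<and> cmod (cdual_apply z u) \<le> norm z" for M
    using exists_norming_functional_off[OF T[of M]] by (metis zero_less_divide_1_iff zero_less_numeral zero_less_power)
  then obtain u :: "nat \<Rightarrow> l1 cdual" where u:
    "\<And>M x. cmod (cdual_apply (u M) x) \<le> norm (l1_restrict (- T M) x)"
    "\<And>M. norm z - 2 * (1 / 2 ^ M) \<le> cmod (cdual_apply z (u M))"
    "\<And>M. cmod (cdual_apply z (u M)) \<le> norm z" by metis
  define q where "q M = sep_poly (T M) A" for M
  define f where "f M = complex_of_real C *\<^sub>C (cdual_to_Au (u M) ^ m * q M ^ n)" for M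
  have f: "norm (f M) \<le> 1" for M
  proof (rule norm_Au_le)
    fix x :: l1 assume x: "x \<in> ball 0 1"
    have "cmod (Au_apply (f M) x) = C * cmod (cdual_apply (u M) x) ^ m * cmod (Au_apply (q M) x) ^ n"
      using C(1) x by (auto simp: f_def scaleC_Au.rep_eq times_Au.rep_eq Au_apply_power
          cdual_to_Au.rep_eq norm_mult norm_power)
    also have "\<dots> \<le> C * norm (l1_restrict (- T M) x) ^ m * ((norm (l1_restrict (T M) x))\<^sup>2) ^ n"
      using C(1) u(1) sep_poly_le unfolding q_def by (intro mult_mono power_mono) auto
    also have "\<dots> \<le> 1"
      unfolding power_mult[symmetric]
      by (rule C(3)) (use norm_l1_restrict_Compl[of "T M" x] x in auto)
    finally show "cmod (Au_apply (f M) x) \<le> 1" .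
  qed
  have val: "\<rho> (f M) = complex_of_real C * (cdual_apply z (u M) ^ m * \<rho> (q M) ^ n)"
    if "\<rho> \<in> Au_fiber z" for \<rho> M
    using that by (simp add: f_def Au_fiber_def Au_spectrum_mult Au_spectrum_power Au_spectrum_scaleC)
  have le: "ereal (C * cmod (cdual_apply z (u M)) ^ m * cmod (\<phi> (q M) ^ n - \<psi> (q M) ^ n)) \<le> Au_functional_dist \<phi> \<psi>"
    for M
  proof -
    have "\<phi> (f M) - \<psi> (f M) = complex_of_real C * (cdual_apply z (u M) ^ m * (\<phi> (q M) ^ n - \<psi> (q M) ^ n))"
      by (simp add: val \<phi> \<psi> algebra_simps)
    then have "cmod (\<phi> (f M) - \<psi> (f M)) = C * cmod (cdual_apply z (u M)) ^ m * cmod (\<phi> (q M) ^ n - \<psi> (q M) ^ n)"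
      using C(1) by (simp add: norm_mult norm_power)
    then show ?thesis
      unfolding Au_functional_dist_def using f by (metis (mono_tags, lifting) SUP_upper mem_Collect_eq)
  qed
  have lim0: "(\<lambda>M. c * (1 / 2 ^ M)) \<longlonglongrightarrow> 0" for c :: real
    using tendsto_mult_right_zero[OF LIMSEQ_power_zero[of "1 / 2 :: real"], of c] by (simp add: power_one_over)
  have "(\<lambda>M. cmod (cdual_apply z (u M))) \<longlonglongrightarrow> norm z"
  proof (rule tendsto_sandwich[OF _ _ _ tendsto_const])
    show "(\<lambda>M. norm z - 2 * (1 / 2 ^ M)) \<longlonglongrightarrow> norm z"
      using tendsto_diff[OF tendsto_const lim0, of "norm z" 2] by simp
  qed (use u in auto)
  moreover have "(\<lambda>M. \<phi> (q M)) \<longlonglongrightarrow> complex_of_real (t\<^sup>2)"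
    by (rule Lim_transform_bound[OF _ lim0[of 3], THEN LIM_zero_cancel])
      (use \<phi>q in \<open>simp add: q_def\<close>)
  moreover have "(\<lambda>M. \<psi> (q M)) \<longlonglongrightarrow> - complex_of_real (t\<^sup>2)"
    by (rule Lim_transform_bound[OF _ lim0[of 3], THEN LIM_zero_cancel])
      (use \<psi>q in \<open>simp add: q_def\<close>)
  ultimately have "(\<lambda>M. C * cmod (cdual_apply z (u M)) ^ m * cmod (\<phi> (q M) ^ n - \<psi> (q M) ^ n))
      \<longlonglongrightarrow> C * norm z ^ m * cmod (complex_of_real (t\<^sup>2) ^ n - (- complex_of_real (t\<^sup>2)) ^ n)"
    by (intro tendsto_intros)
  \<comment> \<open>Odd \<open>n\<close> preserves the opposite signs, so the powers add instead of
    cancelling.\<close>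
  also have "complex_of_real (t\<^sup>2) ^ n - (- complex_of_real (t\<^sup>2)) ^ n = complex_of_real (2 * t ^ (2 * n))"
    using C(2) by (simp add: power_mult)
  also have "cmod \<dots> = 2 * t ^ (2 * n)"
    by (simp only: norm_of_real) simp
  finally have "(\<lambda>M. ereal (C * cmod (cdual_apply z (u M)) ^ m * cmod (\<phi> (q M) ^ n - \<psi> (q M) ^ n)))
      \<longlonglongrightarrow> ereal (C * norm z ^ m * (2 * t ^ (2 * n)))"
    by (rule tendsto_ereal)
  from LIMSEQ_le_const2[OF this] le show ?thesis by (simp add: algebra_simps)
qed

lemma Au_functional_dist_ge_2:
  fixes \<phi> \<psi> :: "l1 Au \<Rightarrow> complex"
  assumes "norm z < 1" "\<phi> \<in> Au_fiber z" "\<psi> \<in> Au_fiber z" "\<And>M. mass_le z (T M) (1 / 2 ^ M)"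
    "\<And>M. cmod (\<phi> (sep_poly (T M) A) - complex_of_real ((1 - norm z)\<^sup>2)) \<le> 3 / 2 ^ M"
    "\<And>M. cmod (\<psi> (sep_poly (T M) A) + complex_of_real ((1 - norm z)\<^sup>2)) \<le> 3 / 2 ^ M"
  shows "2 \<le> Au_functional_dist \<phi> \<psi>"
proof (rule ccontr)
  assume "\<not> ?thesis"
  then have "Au_functional_dist \<phi> \<psi> < ereal 2" by simp
  then obtain r where r: "Au_functional_dist \<phi> \<psi> < ereal r" "ereal r < ereal 2"
    using ereal_dense2 by blast
  \<comment> \<open>The tolerance \<open>(2 - r) / 2\<close> yields a distance of at least
    \<open>r\<close>.\<close>
  show False
  proof (rule exists_peak_monomial[of "1 - norm z" "(2 - r) / 2"])
    fix C :: real and m n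
    assume C: "C \<ge> 0" "odd n"
      "\<And>\<alpha> \<beta>. 0 \<le> \<alpha> \<Longrightarrow> 0 \<le> \<beta> \<Longrightarrow> \<alpha> + \<beta> \<le> 1 \<Longrightarrow> C * \<alpha> ^ m * \<beta> ^ (2 * n) \<le> 1"
      "1 - (2 - r) / 2 \<le> C * (1 - (1 - norm z)) ^ m * (1 - norm z) ^ (2 * n)"
    have "ereal (2 * (C * norm z ^ m * (1 - norm z) ^ (2 * n))) \<le> Au_functional_dist \<phi> \<psi>"
      by (rule Au_functional_dist_ge[OF assms(2-6) C(1-3)])
    also have "\<dots> < ereal r" by (rule r(1))
    finally show False using C(4) by (simp add: mult.assoc diff_divide_distrib)
  qed (use assms(1) r(2) in auto)
qed

subsection \<open>Cardinality\<close>

text \<open>Finitely supported vectors with rational coordinates: a dense set indexed by a countable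
  type.\<close>

definition l1_of_list :: "(rat \<times> rat) list \<Rightarrow> l1" where
  "l1_of_list l = (\<Sum>i<length l. Complex (of_rat (fst (l ! i))) (of_rat (snd (l ! i))) *\<^sub>C l1_unit i)"

lemma of_rat_approx: "\<epsilon> > 0 \<Longrightarrow> \<exists>r. \<bar>x - of_rat r\<bar> < (\<epsilon> :: real)"
proof -
  assume "\<epsilon> > 0"
  then obtain r where "x - \<epsilon> < of_rat r" "of_rat r < x + \<epsilon>"
    using of_rat_dense[of "x - \<epsilon>" "x + \<epsilon>"] by auto
  then show ?thesis by (intro exI[of _ r]) (simp add: abs_less_iff)
qed

lemma complex_rat_approx:
  assumes "\<epsilon> > 0"
  shows "\<exists>r. cmod (c - Complex (of_rat (fst r)) (of_rat (snd r))) < \<epsilon>"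
proof -
  have "\<epsilon> / 2 > 0" using assms by simp
  then obtain a b where ab: "\<bar>Re c - of_rat a\<bar> < \<epsilon> / 2" "\<bar>Im c - of_rat b\<bar> < \<epsilon> / 2"
    using of_rat_approx[of "\<epsilon> / 2" "Re c"] of_rat_approx[of "\<epsilon> / 2" "Im c"] by blast
  have "cmod (c - Complex (of_rat a) (of_rat b)) \<le> \<bar>Re c - of_rat a\<bar> + \<bar>Im c - of_rat b\<bar>"
    using cmod_le[of "c - Complex (of_rat a) (of_rat b)"] by simp
  then show ?thesis using ab by (intro exI[of _ "(a, b)"]) simp
qed

lemma l1_of_list_dense:
  assumes "\<epsilon> > 0"
  shows "\<exists>l. dist (l1_of_list l) x < \<epsilon>"
proof -
  define y where "y = (\<lambda>N. \<Sum>i<N. l1_nth x i *\<^sub>C l1_unit i)"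
  have "y \<longlonglongrightarrow> x"
    using l1_sums[of x] by (simp add: sums_def y_def)
  then have "eventually (\<lambda>N. dist (y N) x < \<epsilon> / 2) sequentially"
    using assms by (intro tendstoD) auto
  then obtain N where N: "dist (y N) x < \<epsilon> / 2"
    by (auto simp: eventually_sequentially)
  \<comment> \<open>\<open>N\<close> errors below \<open>\<delta>\<close> add up to at most
    \<open>\<epsilon> / 2\<close>; the added 1 covers \<open>N = 0\<close>.\<close>
  define \<delta> where "\<delta> = \<epsilon> / 2 / (real N + 1)"
  have "\<delta> > 0" using assms by (simp add: \<delta>_def)
  then have "\<forall>i. \<exists>r. cmod (l1_nth x i - Complex (of_rat (fst r)) (of_rat (snd r))) < \<delta>"
    using complex_rat_approx by blast
  then obtain r where r: "\<And>i. cmod (l1_nth x i - Complex (of_rat (fst (r i))) (of_rat (snd (r i)))) < \<delta>"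
    by metis
  define l where "l = map r [0..<N]"
  have scaleC_diff: "c *\<^sub>C u - d *\<^sub>C u = (c - d) *\<^sub>C u" for c d and u :: l1
    using scaleC_add_left[of "c - d" d u] by simp
  have "dist (y N) (l1_of_list l)
      = norm (\<Sum>i<N. (l1_nth x i - Complex (of_rat (fst (r i))) (of_rat (snd (r i)))) *\<^sub>C l1_unit i)"
    by (simp add: dist_norm y_def l1_of_list_def l_def sum_subtractf[symmetric] scaleC_diff)
  also have "\<dots> \<le> (\<Sum>i<N. \<delta>)"
    by (rule sum_norm_le) (use r in \<open>simp add: norm_scaleC less_imp_le\<close>)
  also have "\<dots> \<le> \<epsilon> / 2"
    using assms by (simp add: \<delta>_def field_simps)
  finally show ?thesis
    using N dist_triangle[of "l1_of_list l" x "y N"] dist_commute[of "l1_of_list l" "y N"]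
    by (intro exI[of _ l]) linarith
qed

text \<open>Inside the ball continuity suffices; outside it both functions are 0 by the
  encoding.\<close>

lemma Au_eqI_dense:
  assumes "\<And>l. Au_apply f (l1_of_list l) = Au_apply g (l1_of_list l)"
  shows "f = g"
proof -
  have "Au_apply f x = Au_apply g x" for x
  proof (cases "x \<in> ball 0 1")
    case False
    then show ?thesis using Au_apply[of f] Au_apply[of g] by (auto simp: Au_set_def)
  next
    case True
    have "\<forall>n. \<exists>l. dist (l1_of_list l) x < inverse (real (Suc n))"
      by (intro allI l1_of_list_dense) simp
    then obtain l where l: "\<forall>n. dist (l1_of_list (l n)) x < inverse (real (Suc n))"
      by (rule choice[THEN exE])
    have "(\<lambda>n. dist (l1_of_list (l n)) x) \<longlonglongrightarrow> 0"
    proof (rule tendsto_sandwich[OF _ _ tendsto_const LIMSEQ_inverse_real_of_nat])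
      show "\<forall>\<^sub>F n in sequentially. dist (l1_of_list (l n)) x \<le> inverse (real (Suc n))"
        using l by (intro always_eventually allI less_imp_le) blast
    qed simp
    then have lim: "(\<lambda>n. l1_of_list (l n)) \<longlonglongrightarrow> x"
      by (rule tendsto_dist_iff[THEN iffD2])
    have "(\<lambda>n. Au_apply h (l1_of_list (l n))) \<longlonglongrightarrow> Au_apply h x" for h
    proof -
      have "continuous_on (ball 0 1) (Au_apply h)"
        using Au_apply[of h] by (auto simp: Au_set_def intro: uniformly_continuous_imp_continuous)
      then have "isCont (Au_apply h) x"
        using True by (simp add: continuous_on_eq_continuous_at)
      then show ?thesis using lim by (rule isCont_tendsto_compose)
    qed
    from this[of f] this[of g] show ?thesis
      unfolding assms by (rule LIMSEQ_unique)
  qed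
  then show ?thesis by (simp add: Au_apply_inject[symmetric] fun_eq_iff)
qed

text \<open>The product of the Dedekind cuts of the real and imaginary parts, which codes a complex
  number as a subset of a countable type.\<close>

definition complex_cut :: "complex \<Rightarrow> (rat \<times> rat) set" where
  "complex_cut c = {(r, s). of_rat r < Re c \<and> of_rat s < Im c}"

lemma inj_complex_cut: "inj complex_cut"
proof (rule injI)
  have le: "Re c \<le> Re d \<and> Im c \<le> Im d" if "complex_cut c \<subseteq> complex_cut d" for c d
  proof (rule ccontr)
    \<comment> \<open>Membership in a cut constrains both coordinates; \<open>r\<close> and
      \<open>s\<close> fill the one that is not compared.\<close>
    obtain r s where rs: "of_rat r < Re c" "of_rat s < Im c"
      using of_rat_dense[of "Re c - 1" "Re c"] of_rat_dense[of "Im c - 1" "Im c"] by auto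
    assume "\<not> ?thesis"
    then consider "Re d < Re c" | "Im d < Im c" by linarith
    then show False
    proof cases
      case 1
      then obtain q where "Re d < of_rat q" "of_rat q < Re c" using of_rat_dense by blast
      then have "(q, s) \<in> complex_cut c" "(q, s) \<notin> complex_cut d"
        using rs by (auto simp: complex_cut_def)
      then show False using that by blast
    next
      case 2
      then obtain q where "Im d < of_rat q" "of_rat q < Im c" using of_rat_dense by blast
      then have "(r, q) \<in> complex_cut c" "(r, q) \<notin> complex_cut d"
        using rs by (auto simp: complex_cut_def)
      then show False using that by blast
    qed
  qed
  show "c = d" if "complex_cut c = complex_cut d" for c d
    using le[of c d] le[of d c] that by (simp add: complex_eq_iff)
qed

text \<open>Coding complex-valued functions as sets reduces the cardinal bounds to power
  sets.\<close>

lemma inj_cut_fun: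
  assumes "\<And>f g. (\<And>x. F f x = F g x) \<Longrightarrow> f = g"
  shows "inj (\<lambda>f. {(x, q). q \<in> complex_cut (F f x)})"
proof (rule injI)
  fix f g assume "{(x, q). q \<in> complex_cut (F f x)} = {(x, q). q \<in> complex_cut (F g x)}"
  then have "complex_cut (F f x) = complex_cut (F g x)" for x by blast
  then show "f = g" using assms inj_complex_cut by (meson injD)
qed

lemma lepoll_UNIV_set:
  assumes "(UNIV :: 'a set) \<lesssim> (UNIV :: 'b set)"
  shows "(UNIV :: 'a set set) \<lesssim> (UNIV :: 'b set set)"
proof -
  obtain h :: "'a \<Rightarrow> 'b" where "inj h" using assms by (auto simp: lepoll_def)
  then have "inj (image h)" by (simp add: inj_def inj_image_eq_iff)
  then show ?thesis by (auto simp: lepoll_def)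
qed

lemma lepoll_UNIV_countable: "(UNIV :: 'a::countable set) \<lesssim> (UNIV :: nat set)"
  using inj_to_nat by (auto simp: lepoll_def)

lemma Au_l1_lepoll: "(UNIV :: l1 Au set) \<lesssim> (UNIV :: nat set set)"
proof -
  have "inj (\<lambda>f. {(l, q). q \<in> complex_cut (Au_apply f (l1_of_list l))})"
    by (rule inj_cut_fun) (rule Au_eqI_dense)
  then have "(UNIV :: l1 Au set) \<lesssim> (UNIV :: ((rat \<times> rat) list \<times> rat \<times> rat) set set)"
    by (auto simp: lepoll_def)
  also have "\<dots> \<lesssim> (UNIV :: nat set set)"
    by (rule lepoll_UNIV_set[OF lepoll_UNIV_countable])
  finally show ?thesis .
qed

lemma Au_l1_spectrum_lepoll: "(Au_spectrum :: (l1 Au \<Rightarrow> complex) set) \<lesssim> (UNIV :: real set set)"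
proof -
  obtain h :: "l1 Au \<Rightarrow> nat set" where h: "inj h"
    using Au_l1_lepoll by (auto simp: lepoll_def)
  \<comment> \<open>The even elements store \<open>h f\<close>, the single odd element stores
    \<open>q\<close>.\<close>
  define e where "e = (\<lambda>(f, q :: rat \<times> rat). {n. (\<exists>k\<in>h f. n = 2 * k) \<or> n = 2 * to_nat q + 1})"
  have "inj e"
  proof (rule injI)
    fix x y assume xy: "e x = e y"
    obtain f p g q where fg: "x = (f, p)" "y = (g, q)" by (cases x; cases y)
    have "2 * k \<noteq> Suc (2 * j)" for j k :: nat by presburger
    then have "k \<in> h f \<longleftrightarrow> 2 * k \<in> e x" "k \<in> h g \<longleftrightarrow> 2 * k \<in> e y"
      "j = to_nat p \<longleftrightarrow> 2 * j + 1 \<in> e x" "j = to_nat q \<longleftrightarrow> 2 * j + 1 \<in> e y" for j k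
      by (auto simp: fg e_def dest: sym)
    then have "h f = h g" "to_nat p = to_nat q" using xy by blast+
    then show "x = y" using h by (simp add: fg inj_eq)
  qed
  then have "(UNIV :: (l1 Au \<times> rat \<times> rat) set) \<lesssim> (UNIV :: nat set set)"
    by (auto simp: lepoll_def)
  moreover have "inj (\<lambda>\<phi> :: l1 Au \<Rightarrow> complex. {(f, q). q \<in> complex_cut (\<phi> f)})"
    by (rule inj_cut_fun) (rule ext)
  then have "(Au_spectrum :: (l1 Au \<Rightarrow> complex) set) \<lesssim> (UNIV :: (l1 Au \<times> rat \<times> rat) set set)"
    by (auto simp: lepoll_def intro: inj_on_subset)
  ultimately have "(Au_spectrum :: (l1 Au \<Rightarrow> complex) set) \<lesssim> (UNIV :: nat set set set)"
    using lepoll_UNIV_set lepoll_trans by blast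
  also have "\<dots> \<lesssim> (UNIV :: real set set)"
    by (rule lepoll_UNIV_set[OF eqpoll_imp_lepoll[OF nat_sets_eqpoll_reals]])
  finally show ?thesis .
qed

section \<open>Counting the Gleason parts that meet the fiber\<close>

lemma Au_functional_dist_self: "Au_functional_dist \<phi> \<phi> \<le> 0"
  by (simp add: Au_functional_dist_def SUP_le_iff)

lemma Au_functional_dist_commute: "Au_functional_dist \<phi> \<psi> = Au_functional_dist \<psi> \<phi>"
  by (simp add: Au_functional_dist_def norm_minus_commute)

theorem theorem4p1:
  fixes z :: "l1 cdual cdual"
  assumes "norm z < 1"
  shows "{P \<in> gleason_part ` Au_spectrum. P \<inter> Au_fiber z \<noteq> {}} \<approx> (UNIV :: real set set)"
proof (rule lepoll_antisym)
  have "{P \<in> gleason_part ` Au_spectrum. P \<inter> Au_fiber z \<noteq> {}} \<lesssim> (Au_spectrum :: (l1 Au \<Rightarrow> complex) set)"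
    by (rule subset_image_lepoll[of _ gleason_part]) blast
  also note Au_l1_spectrum_lepoll
  finally show "{P \<in> gleason_part ` Au_spectrum. P \<inter> Au_fiber z \<noteq> {}} \<lesssim> (UNIV :: real set set)" .
next
  obtain d where d: "strict_mono d" "\<And>M. mass_le z (d ` {M..}) (norm z / 2 ^ M)"
    using exists_thin_sequence[of z] by blast
  have mass: "mass_le z (d ` {M..}) (1 / 2 ^ M)" for M
    by (rule mass_le_subset[OF d(2) order_refl]) (use assms in \<open>simp add: divide_right_mono\<close>)
  define v where "v S X = (if X \<in> S then 1 else - 1) * complex_of_real ((1 - norm z)\<^sup>2)" for S and X :: "nat set"
  have "\<forall>S. \<exists>\<phi>. \<phi> \<in> Au_fiber z \<and>
      (\<forall>X M. cmod (\<phi> (sep_poly (d ` {M..}) (d ` indep X)) - v S X) \<le> 3 / 2 ^ M)"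
    using exists_fiber_character[OF assms d(1) mass] unfolding v_def by blast
  then obtain \<phi> where "\<forall>S. \<phi> S \<in> Au_fiber z \<and>
      (\<forall>X M. cmod (\<phi> S (sep_poly (d ` {M..}) (d ` indep X)) - v S X) \<le> 3 / 2 ^ M)"
    by (rule choice[THEN exE])
  then have \<phi>: "\<phi> S \<in> Au_fiber z" "cmod (\<phi> S (sep_poly (d ` {M..}) (d ` indep X)) - v S X) \<le> 3 / 2 ^ M"
    for S X M by blast+
  have spec: "\<phi> S \<in> Au_spectrum" for S using \<phi>(1)[of S] by (simp add: Au_fiber_def)
  \<comment> \<open>The polynomials built from \<open>indep X\<close> take nearly opposite values at
    the two characters.\<close>
  have dist: "2 \<le> Au_functional_dist (\<phi> S) (\<phi> S')" if "X \<in> S" "X \<notin> S'" for X S S'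
    by (rule Au_functional_dist_ge_2[OF assms \<phi>(1) \<phi>(1) mass, where A = "d ` indep X"])
      (use \<phi>(2)[of S _ X] \<phi>(2)[of S' _ X] that in \<open>auto simp: v_def\<close>)
  have self: "\<phi> S \<in> gleason_part (\<phi> S)" for S
    using spec Au_functional_dist_self[of "\<phi> S"] by (auto simp: gleason_part_def intro: le_less_trans)
  \<comment> \<open>Equal parts would put \<open>\<phi> S'\<close> into the part of
    \<open>\<phi> S\<close>, at distance below 2.\<close>
  have "inj (\<lambda>S. gleason_part (\<phi> S))"
  proof (rule injI, rule ccontr)
    fix S S' assume eq: "gleason_part (\<phi> S) = gleason_part (\<phi> S')" and "S \<noteq> S'"
    then obtain X where "X \<in> S \<and> X \<notin> S' \<or> X \<in> S' \<and> X \<notin> S" by blast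
    then have "2 \<le> Au_functional_dist (\<phi> S) (\<phi> S')"
      using dist Au_functional_dist_commute by metis
    moreover have "Au_functional_dist (\<phi> S) (\<phi> S') < 2"
      using self[of S'] eq by (auto simp: gleason_part_def)
    ultimately show False by simp
  qed
  moreover have "range (\<lambda>S. gleason_part (\<phi> S)) \<subseteq> {P \<in> gleason_part ` Au_spectrum. P \<inter> Au_fiber z \<noteq> {}}"
    using spec self \<phi>(1) by blast
  ultimately have "(UNIV :: nat set set set) \<lesssim> {P \<in> gleason_part ` Au_spectrum. P \<inter> Au_fiber z \<noteq> {}}"
    unfolding lepoll_def by blast
  then show "(UNIV :: real set set) \<lesssim> {P \<in> gleason_part ` Au_spectrum. P \<inter> Au_fiber z \<noteq> {}}"
    using lepoll_UNIV_set[OF eqpoll_imp_lepoll[OF eqpoll_sym[OF nat_sets_eqpoll_reals]]] lepoll_trans by blast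
qed

end
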